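(* Let $0<p\le\infty$, $\omega\in\Omega$, and $u\in\mathcal{B}(p)\cap\mathcal{R}_{int}(p)$. Then there exists a constant $C=C(\omega,u,p)$ such that for every integer $n\ge1$ and every trigonometric polynomial $T_n$ of degree at most $n$, $$\|T_n'\|_{L_p(\omega u)}\le C\,n\,\|T_n\|_{L_p(\omega u)}.$$
   Context: $\mathbb{T}=\mathbb{R}/2\pi\mathbb{Z}$; $|E|$ is Lebesgue measure. A weight is a nonnegative integrable function on $\mathbb{T}$. For a weight $w$ and measurable $E\subset\mathbb{T}$: $\|f\|_{L_p(w,E)}=\left(\int_E|f|^pw\right)^{1/p}$ if $0<p<\infty$, $\|f\|_{L_\infty(w,E)}=\operatorname{ess\,sup}_{t\in E}|f(t)w(t)|$, and $\|f\|_{L_p(w)}=\|f\|_{L_p(w,\mathbb{T})}$. Class $\mathcal{B}(p)$: a weight $u$ belongs to $\mathcal{B}(p)$ if there is $C=C(p,u)$ such that $\|T_n'\|_{L_p(u)}\le C\,n\,\|T_n\|_{L_p(u)}$ for every $n\ge1$ and every trigonometric polynomial $T_n$ of degree at most $n$. Class $\mathcal{R}_{int}(p)$: a weight $u$ belongs to $\mathcal{R}_{int}(p)$ if there is $C=C(p,u)>0$ such that for every $n\ge1$ and every trigonometric polynomial $T_n$ of degree at most $n$, $\|T_n\|_{L_p(u,\mathbb{T})}\le\exp(Cn|E|)\|T_n\|_{L_p(u,\mathbb{T}\setminus E)}$ for all sets $E\subset\mathbb{T}$ which are a finite union of intervals of length $\ge1/n$ and such that $|E|\le1$. Class $\Omega$: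 $\omega\in\Omega$ if $\omega(t)=\exp(-F(g(t)))$, $t\in\mathbb{T}$ (with $\omega(t)=0$ where $g(t)=0$), where for some $A>0$: - $g:\mathbb{T}\to[-A,A]$ is real analytic, i.e. for some $D>0$, $|g^{(n)}(t)|\le D^n n!$ for all $t\in\mathbb{T}$, $n\ge 1$; each zero of $g$ has multiplicity one; and $g$ has at least one zero on $\mathbb{T}$; - $F:[-A,A]\setminus\{0\}\to(0,\infty)$ is even, $C^\infty$ on $(0,A]$, and satisfies: (F1) $F(x)\to\infty$ as $x\to0+$; (F2) $F$ is decreasing on $(0,A]$; (F3) for some $B>0$, $|F^{(n)}(x)|\le B^n n^n F(x)/x^n$ for $x\in(0,A]$, $n=1,2,\dots$; (F4) there exist $A_1,A_2>0$ with $A_2\le |F'(x)|x/F(x)\le A_1$ for $x\in(0,A]$. *)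

theory Defs
  imports "HOL-Probability.Essential_Supremum"
begin

text \<open>
  Functions on the circle \<open>\<real>/2\<pi>\<int>\<close> are \<open>2\<pi>\<close>-periodic functions on the reals; subsets of the circle
  are represented by subsets of the fundamental domain \<^term>\<open>{0..<2*pi}\<close>.
\<close>

definition circle :: "real set" where
  "circle = {0..<2 * pi}"

definition periodic_2pi :: "(real \<Rightarrow> 'a) \<Rightarrow> bool" where
  "periodic_2pi f \<longleftrightarrow> (\<forall>t. f (t + 2 * pi) = f t)"

text \<open>The image of a subset of the reals under the quotient map onto the circle.\<close>

definition circle_proj :: "real set \<Rightarrow> real set" where
  "circle_proj S = {t \<in> circle. \<exists>k::int. t + 2 * pi * of_int k \<in> S}"

definition weight :: "(real \<Rightarrow> real) \<Rightarrow> bool" where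
  "weight w \<longleftrightarrow> periodic_2pi w \<and> (\<forall>t. 0 \<le> w t) \<and> set_integrable lebesgue circle w"

definition trig_poly :: "nat \<Rightarrow> (real \<Rightarrow> complex) \<Rightarrow> bool" where
  "trig_poly n T \<longleftrightarrow>
     (\<exists>c :: int \<Rightarrow> complex. T = (\<lambda>t. \<Sum>k\<in>{- int n..int n}. c k * cis (of_int k * t)))"

definition ennreal_powr :: "ennreal \<Rightarrow> real \<Rightarrow> ennreal" where
  "ennreal_powr x a = (if x = \<infinity> then \<infinity> else ennreal (enn2real x powr a))"

text \<open>
  For \<open>p = \<infinity>\<close> the weight multiplies the function inside the essential supremum,
  so the norm is infinite when that product is essentially unbounded.
\<close>

definition Lp_norm :: "ennreal \<Rightarrow> (real \<Rightarrow> real) \<Rightarrow> real set \<Rightarrow> (real \<Rightarrow> complex) \<Rightarrow> ennreal" where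
  "Lp_norm p w E f =
     (if p = \<infinity>
      then esssup (restrict_space lebesgue E) (\<lambda>t. ennreal (cmod (f t * of_real (w t))))
      else ennreal_powr
             (\<integral>\<^sup>+t\<in>E. ennreal (cmod (f t) powr enn2real p * w t) \<partial>lebesgue)
             (1 / enn2real p))"

definition class_B :: "ennreal \<Rightarrow> (real \<Rightarrow> real) set" where
  "class_B p = {u. weight u \<and>
     (\<exists>C::real. C > 0 \<and> (\<forall>n\<ge>1. \<forall>T. trig_poly n T \<longrightarrow>
        Lp_norm p u circle (\<lambda>t. vector_derivative T (at t))
          \<le> ennreal (C * real n) * Lp_norm p u circle T))}"

text \<open>
  Intervals on the circle are projections of real intervals from \<open>a\<close> to \<open>b\<close>, with or without
  their endpoints.
\<close>

definition interval_union :: "real \<Rightarrow> real set \<Rightarrow> bool" where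
  "interval_union l E \<longleftrightarrow>
     (\<exists>\<I>. finite \<I> \<and>
        (\<forall>I\<in>\<I>. \<exists>a b. l \<le> b - a \<and> {a<..<b} \<subseteq> I \<and> I \<subseteq> {a..b}) \<and>
        E = circle_proj (\<Union>\<I>))"

definition class_R_int :: "ennreal \<Rightarrow> (real \<Rightarrow> real) set" where
  "class_R_int p = {u. weight u \<and>
     (\<exists>C::real. C > 0 \<and> (\<forall>n\<ge>1. \<forall>T. trig_poly n T \<longrightarrow>
        (\<forall>E. interval_union (1 / real n) E \<and> measure lebesgue E \<le> 1 \<longrightarrow>
           Lp_norm p u circle T
             \<le> ennreal (exp (C * real n * measure lebesgue E)) * Lp_norm p u (circle - E) T)))}"

text \<open>
  \<^term>\<open>d\<close> is the sequence of successive derivatives of \<^term>\<open>f\<close> on \<^term>\<open>S\<close>, one-sided at endpoints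
  that belong to \<^term>\<open>S\<close>.  For a nondegenerate interval it is determined on \<^term>\<open>S\<close> by \<^term>\<open>f\<close>,
  and it exists iff \<^term>\<open>f\<close> is infinitely differentiable on \<^term>\<open>S\<close>.
\<close>

definition derivs_on :: "real set \<Rightarrow> (real \<Rightarrow> real) \<Rightarrow> (nat \<Rightarrow> real \<Rightarrow> real) \<Rightarrow> bool" where
  "derivs_on S f d \<longleftrightarrow>
     (\<forall>x\<in>S. d 0 x = f x) \<and>
     (\<forall>n. \<forall>x\<in>S. (d n has_real_derivative d (Suc n) x) (at x within S))"

definition admissible_g :: "real \<Rightarrow> (real \<Rightarrow> real) \<Rightarrow> bool" where
  "admissible_g A g \<longleftrightarrow>
     periodic_2pi g \<and>
     (\<forall>t. g t \<in> {-A..A}) \<and>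
     (\<exists>d. derivs_on UNIV g d \<and>
        (\<exists>D>0. \<forall>n\<ge>1. \<forall>t. \<bar>d n t\<bar> \<le> D ^ n * fact n) \<and>
        (\<forall>t. g t = 0 \<longrightarrow> d 1 t \<noteq> 0)) \<and>
     (\<exists>t. g t = 0)"

text \<open>Only the values of \<^term>\<open>F\<close> on \<^term>\<open>{-A..A} - {0}\<close> matter.\<close>

definition admissible_F :: "real \<Rightarrow> (real \<Rightarrow> real) \<Rightarrow> bool" where
  "admissible_F A F \<longleftrightarrow>
     (\<forall>x\<in>{-A..A} - {0}. F x > 0 \<and> F (- x) = F x) \<and>
     filterlim F at_top (at_right 0) \<and>
     antimono_on {0<..A} F \<and>
     (\<exists>d. derivs_on {0<..A} F d \<and>
        (\<exists>B>0. \<forall>n\<ge>1. \<forall>x\<in>{0<..A}. \<bar>d n x\<bar> \<le> B ^ n * real n ^ n * F x / x ^ n) \<and>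
        (\<exists>A1>0. \<exists>A2>0. \<forall>x\<in>{0<..A}. A2 \<le> \<bar>d 1 x\<bar> * x / F x \<and> \<bar>d 1 x\<bar> * x / F x \<le> A1))"

definition class_Omega :: "(real \<Rightarrow> real) set" where
  "class_Omega = {\<omega>. \<exists>A>0. \<exists>g F. admissible_g A g \<and> admissible_F A F \<and>
     \<omega> = (\<lambda>t. if g t = 0 then 0 else exp (- F (g t)))}"

end

theory Submission
  imports Defs
begin

text \<open>
  Write \<open>\<omega> = V\<^sup>p\<close> (or \<open>\<omega> = V\<close> for infinite \<open>p\<close>), so that the norm of \<open>f\<close> with weight \<open>\<omega> u\<close> is the
  norm of \<open>V f\<close> with weight \<open>u\<close>. Up to a positive factor in \<open>F\<close>, \<open>V\<close> is again of the form
  \<open>exp(-F(g))\<close>. The idea is to replace \<open>V\<close> by a positive trigonometric polynomial \<open>q\<close> whose degree and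
  logarithmic derivative are of order \<open>n\<close>. Then \<open>q T' = (q T)' - q' T\<close>, and the Bernstein inequality
  for \<open>u\<close>, applied to the polynomial \<open>q T\<close>, bounds the norm of \<open>q T'\<close> by \<open>n\<close> times that of \<open>q T\<close>.

  Such a \<open>q\<close> can only be comparable to \<open>V\<close> where the logarithm of \<open>V\<close> has slope of order \<open>n\<close>, that is,
  where \<open>\<bar>g\<bar> \<ge> \<xi>\<close> with \<open>F(\<xi>) / \<xi>\<close> of order \<open>n\<close>. Closer to the zeros of \<open>g\<close> the exponent is flattened
  to an even parabola (\<open>flattened_profile\<close>). What happens there is negligible: \<open>V\<close> and \<open>q\<close> are at most
  of order \<open>exp(-F(\<xi>))\<close>, whereas the Remez inequality for \<open>u\<close> together with the size of \<open>V\<close> at a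
  slightly larger distance bounds the norm of \<open>T\<close> by \<open>exp(F(\<xi>))\<close> times that of \<open>V T\<close>. The scale
  (\<open>choose_scale\<close>) is selected so that both the loss in the Remez inequality and the size of \<open>1 / V\<close> at
  that distance are at most \<open>exp(F(\<xi>) / 2)\<close>. This is carried out in \<open>bernstein_singular_profile\<close>.

  It remains to construct \<open>q\<close> (\<open>exp_approx_slowly_varying\<close>). The flattened exponent \<open>H\<close> has size
  \<open>M\<close>, first derivative \<open>M m\<close> and a second difference quotient of order \<open>M m\<^sup>2\<close>, where \<open>M\<close> is of order
  \<open>F(\<xi>)\<close>, \<open>m\<close> of order \<open>1 / \<xi>\<close>, and thus \<open>M m\<close> of order \<open>n\<close>. Jackson's theorem approximates \<open>H\<close> by
  trigonometric polynomials of degree \<open>2\<^sup>k m\<close> with error of order \<open>M 4\<^sup>-\<^sup>k\<close>. The exponential of each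
  difference of consecutive approximants is replaced by a Taylor polynomial of order proportional to
  the size \<open>M 4\<^sup>-\<^sup>k\<close> of that difference, and \<open>q\<close> is the product of these. Its degree is of order
  \<open>\<Sum>\<^sub>k M 4\<^sup>-\<^sup>k 2\<^sup>k m\<close>, hence of order \<open>M m\<close>.
\<close>

section \<open>The algebra of trigonometric polynomials\<close>

lemma trig_poly_monomial:
  assumes "\<bar>k\<bar> \<le> int n"
  shows "trig_poly n (\<lambda>t. c * cis (of_int k * t))"
proof -
  have "c * cis (of_int k * t)
      = (\<Sum>j\<in>{- int n..int n}. (if j = k then c else 0) * cis (of_int j * t))" for t
    using assms by (simp add: if_distrib[where f = "\<lambda>x. x * _"] sum.delta abs_le_iff cong: if_cong)
  then show ?thesis
    unfolding trig_poly_def by (intro exI[of _ "\<lambda>j. if j = k then c else 0"] ext) simp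
qed

lemma trig_poly_add:
  assumes "trig_poly n S" "trig_poly n T"
  shows "trig_poly n (\<lambda>t. S t + T t)"
proof -
  obtain c d where
    "S = (\<lambda>t. \<Sum>k\<in>{- int n..int n}. c k * cis (of_int k * t))"
    "T = (\<lambda>t. \<Sum>k\<in>{- int n..int n}. d k * cis (of_int k * t))"
    using assms unfolding trig_poly_def by blast
  then show ?thesis
    unfolding trig_poly_def
    by (intro exI[of _ "\<lambda>k. c k + d k"]) (simp add: sum.distrib algebra_simps)
qed

lemma trig_poly_const: "trig_poly n (\<lambda>t. c)"
  using trig_poly_monomial[of 0 n c] by simp

lemma trig_poly_sum:
  assumes "\<And>i. i \<in> I \<Longrightarrow> trig_poly n (T i)"
  shows "trig_poly n (\<lambda>t. \<Sum>i\<in>I. T i t)"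
  using assms
  by (induction I rule: infinite_finite_induct) (auto intro: trig_poly_const trig_poly_add)

lemma trig_poly_mult:
  assumes "trig_poly m S" "trig_poly n T"
  shows "trig_poly (m + n) (\<lambda>t. S t * T t)"
proof -
  obtain c d where
    S: "S = (\<lambda>t. \<Sum>k\<in>{- int m..int m}. c k * cis (of_int k * t))" and
    T: "T = (\<lambda>t. \<Sum>k\<in>{- int n..int n}. d k * cis (of_int k * t))"
    using assms unfolding trig_poly_def by blast
  have "(\<lambda>t. S t * T t) = (\<lambda>t. \<Sum>j\<in>{- int m..int m}. \<Sum>k\<in>{- int n..int n}.
          (c j * d k) * cis (of_int (j + k) * t))"
    unfolding S T sum_product by (simp add: distrib_right flip: cis_mult) (simp add: mult_ac)
  moreover have "trig_poly (m + n) (\<lambda>t. (c j * d k) * cis (of_int (j + k) * t))"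
    if "j \<in> {- int m..int m}" "k \<in> {- int n..int n}" for j k
    using that by (intro trig_poly_monomial) auto
  ultimately show ?thesis
    by (simp only: trig_poly_sum)
qed

lemma trig_poly_mono:
  assumes "trig_poly m T" "m \<le> n"
  shows "trig_poly n T"
  using trig_poly_mult[OF assms(1) trig_poly_const[of "n - m" 1]] assms(2) by simp

lemma trig_poly_power:
  assumes "trig_poly n T"
  shows "trig_poly (k * n) (\<lambda>t. T t ^ k)"
  by (induction k) (auto intro: trig_poly_const trig_poly_mult[OF assms])

lemma trig_poly_has_derivative:
  assumes "trig_poly n T"
  obtains T' where "trig_poly n T'" "\<And>t. (T has_vector_derivative T' t) (at t)"
proof -
  obtain c where T: "T = (\<lambda>t. \<Sum>k\<in>{- int n..int n}. c k * cis (of_int k * t))"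
    using assms unfolding trig_poly_def by blast
  define T' where "T' = (\<lambda>t. \<Sum>k\<in>{- int n..int n}. (c k * (\<i> * of_int k)) * cis (of_int k * t))"
  have "((\<lambda>t. cis (of_int k * t)) has_vector_derivative (\<i> * of_int k) * cis (of_int k * t)) (at t)"
    for k t
    unfolding cis_conv_exp
    by (auto intro!: derivative_eq_intros has_vector_derivative_real_field simp: mult_ac)
  then have "(T has_vector_derivative T' t) (at t)" for t
    unfolding T T'_def
    by (auto intro!: has_vector_derivative_sum has_vector_derivative_mult_right simp: mult.assoc)
  moreover have "trig_poly n T'"
    unfolding T'_def by (intro trig_poly_sum trig_poly_monomial) auto
  ultimately show ?thesis using that by blast
qed

lemma trig_poly_continuous:
  assumes "trig_poly n T"
  shows "continuous_on S T"
  using trig_poly_has_derivative[OF assms]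
  by (meson continuous_at_imp_continuous_on has_vector_derivative_continuous)

lemma trig_poly_cos:
  assumes "\<bar>k\<bar> \<le> int n"
  shows "trig_poly n (\<lambda>t. complex_of_real (cos (of_int k * t)))"
proof -
  have "complex_of_real (cos (of_int k * t))
      = 1/2 * cis (of_int k * t) + 1/2 * cis (of_int (- k) * t)" for t
    by (simp add: complex_eq_iff)
  moreover have "trig_poly n (\<lambda>t. 1/2 * cis (of_int k * t) + 1/2 * cis (of_int (- k) * t))"
    using assms by (intro trig_poly_add trig_poly_monomial) auto
  ultimately show ?thesis
    by presburger
qed

lemma trig_poly_sin:
  assumes "\<bar>k\<bar> \<le> int n"
  shows "trig_poly n (\<lambda>t. complex_of_real (sin (of_int k * t)))"
proof -
  have "complex_of_real (sin (of_int k * t))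
      = (- \<i>/2) * cis (of_int k * t) + \<i>/2 * cis (of_int (- k) * t)" for t
    by (simp add: complex_eq_iff)
  moreover have "trig_poly n (\<lambda>t. (- \<i>/2) * cis (of_int k * t) + \<i>/2 * cis (of_int (- k) * t))"
    using assms by (intro trig_poly_add trig_poly_monomial) auto
  ultimately show ?thesis
    by presburger
qed

section \<open>Approximation of smooth periodic functions\<close>

lemma continuous_antiderivative:
  fixes f :: "real \<Rightarrow> real"
  assumes "continuous_on UNIV f"
  obtains G where "\<And>x. DERIV G x :> f x"
proof -
  have "\<exists>G. \<forall>x. - \<infinity> < ereal x \<longrightarrow> ereal x < \<infinity> \<longrightarrow> (G has_vector_derivative f x) (at x)"
    using assms by (intro einterval_antiderivative) (auto simp: continuous_on_eq_continuous_at)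
  then show ?thesis
    using that by (auto simp: has_real_derivative_iff_has_vector_derivative)
qed

lemma integral_periodic_reflect:
  fixes f :: "real \<Rightarrow> real"
  assumes cont: "continuous_on UNIV f" and per: "\<And>x. f (x + 2 * pi) = f x"
  shows "integral {-pi..pi} (\<lambda>s. f (t - s)) = integral {-pi..pi} f"
proof -
  obtain G where G: "\<And>x. DERIV G x :> f x"
    using continuous_antiderivative[OF cont] by blast
  have int: "(f has_integral G pi - G (- pi)) {- pi..pi}"
    by (intro fundamental_theorem_of_calculus)
       (auto intro!: G has_field_derivative_at_within
             simp flip: has_real_derivative_iff_has_vector_derivative)
  have int': "((\<lambda>s. f (t - s)) has_integral - G (t - pi) - (- G (t - - pi))) {- pi..pi}"
    by (intro fundamental_theorem_of_calculus)
       (auto intro!: derivative_eq_intros DERIV_chain'[OF _ G]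
             simp flip: has_real_derivative_iff_has_vector_derivative)
  have "((\<lambda>x. G (x + pi) - G (x - pi)) has_real_derivative 0) (at x)" for x
  proof -
    have "f (x + pi) = f (x - pi)"
      using per[of "x - pi"] by (simp add: algebra_simps)
    then show ?thesis
      by (auto intro!: derivative_eq_intros DERIV_chain'[OF _ G])
  qed
  then have "G (t + pi) - G (t - pi) = G (0 + pi) - G (0 - pi)"
    by (intro DERIV_isconst_all) auto
  then show ?thesis
    using integral_unique[OF int] integral_unique[OF int'] by simp
qed

lemma integral_cos_int:
  "integral {-pi..pi} (\<lambda>s. cos (of_int k * s)) = (if k = 0 then 2 * pi else 0)"
proof (cases "k = 0")
  case False
  have "((\<lambda>s. cos (of_int k * s)) has_integral sin (of_int k * pi) / k - sin (of_int k * (- pi)) / k)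
      {-pi..pi}"
    using False
    by (intro fundamental_theorem_of_calculus)
       (auto intro!: derivative_eq_intros simp flip: has_real_derivative_iff_has_vector_derivative)
  then show ?thesis
    using False by (simp add: integral_unique sin_integer_2pi mult.commute[of _ pi])
qed auto

text \<open>
  The numbers \<open>sin (k x)\<close> satisfy \<open>s\<^sub>k\<^sub>-\<^sub>1 + s\<^sub>k\<^sub>+\<^sub>1 = 2 cos x s\<^sub>k\<close>, and the choice of \<open>x\<close> makes the boundary
  terms vanish when this is multiplied by \<open>s\<^sub>k\<close> and summed: they are an eigenvector of the adjacency
  matrix of a path.
\<close>
lemma sum_sin_consecutive:
  fixes m :: nat and x :: real
  assumes x_def: "x = pi / real (m + 1)"
  shows "(\<Sum>k\<le>m. sin (k * x) * sin (Suc k * x)) = cos x * (\<Sum>k\<le>m. (sin (k * x))\<^sup>2)"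
proof -
  have last: "sin (Suc m * x) = 0"
    by (simp add: x_def)
  have "(\<Sum>k\<le>m. sin (Suc k * x) * sin (Suc (Suc k) * x)) + 0 = (\<Sum>k\<le>Suc m. sin (k * x) * sin (Suc k * x))"
    by (subst sum.atMost_Suc_shift) simp
  have two: "2 * cos x * (sin (Suc k * x))\<^sup>2
      = sin (k * x) * sin (Suc k * x) + sin (Suc k * x) * sin (Suc (Suc k) * x)" for k
  proof -
    have "sin (k * x) + sin (Suc (Suc k) * x) = 2 * cos x * sin (Suc k * x)"
      using sin_add[of "Suc k * x" x] sin_diff[of "Suc k * x" x]
      by (simp add: algebra_simps)
    from arg_cong[OF this, of "\<lambda>y. y * sin (Suc k * x)"] show ?thesis
      by (simp add: algebra_simps power2_eq_square)
  qed
  have "2 * cos x * (\<Sum>k\<le>Suc m. (sin (k * x))\<^sup>2)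
      = (\<Sum>k\<le>m. 2 * cos x * (sin (Suc k * x))\<^sup>2)"
    by (subst sum.atMost_Suc_shift) (simp add: sum_distrib_left)
  also have "\<dots> = (\<Sum>k\<le>m. sin (k * x) * sin (Suc k * x))
      + (\<Sum>k\<le>m. sin (Suc k * x) * sin (Suc (Suc k) * x))"
    unfolding two sum.distrib ..
  also have "(\<Sum>k\<le>m. sin (Suc k * x) * sin (Suc (Suc k) * x))
      = (\<Sum>k\<le>Suc m. sin (k * x) * sin (Suc k * x))"
    by (subst sum.atMost_Suc_shift) simp
  finally show ?thesis
    using last by simp
qed

lemma power2_le_one_minus_cos:
  fixes s :: real
  assumes "\<bar>s\<bar> \<le> pi"
  shows "s\<^sup>2 \<le> 12 * (1 - cos s)"
proof -
  \<comment> \<open>The fourth order Taylor bound suffices because \<open>1/2 - pi\<^sup>2/24\<close> still exceeds \<open>1/12\<close>.\<close>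
  obtain t where t: "cos s = (\<Sum>m<4. cos_coeff m * s ^ m) + cos (t + 1/2 * real 4 * pi) / fact 4 * s ^ 4"
    using Maclaurin_cos_expansion[of s 4] by blast
  have "(\<Sum>m<4. cos_coeff m * s ^ m) = 1 - s\<^sup>2 / 2"
    by (simp add: lessThan_nat_numeral lessThan_Suc cos_coeff_def)
  moreover have "cos (t + 1/2 * real 4 * pi) * s ^ 4 \<le> 1 * s ^ 4"
    by (intro mult_right_mono) auto
  ultimately have "cos s \<le> 1 - s\<^sup>2 / 2 + s ^ 4 / 24"
    unfolding t by (simp add: fact_numeral)
  moreover have "s\<^sup>2 \<le> 10"
  proof -
    have "s\<^sup>2 \<le> pi\<^sup>2" using assms by (intro power2_le_iff_abs_le[THEN iffD2]) auto
    also have "\<dots> \<le> (3.15)\<^sup>2" using pi_approx by (intro power_mono) auto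
    finally show ?thesis by (simp add: power2_eq_square)
  qed
  then have "s\<^sup>2 * s\<^sup>2 \<le> 10 * s\<^sup>2"
    by (intro mult_right_mono) auto
  then have "s ^ 4 \<le> 10 * s\<^sup>2"
    by (simp add: power4_eq_xxxx power2_eq_square mult.assoc)
  ultimately show ?thesis by (simp add: field_simps)
qed

lemma one_minus_cos_le: "1 - cos x \<le> x\<^sup>2 / 2" for x :: real
proof -
  have "cos x = 1 - 2 * (sin (x / 2))\<^sup>2"
    using cos_double_sin[of "x / 2"] by simp
  moreover have "(sin (x / 2))\<^sup>2 \<le> (x / 2)\<^sup>2"
    unfolding abs_le_square_iff[symmetric] by (rule abs_sin_x_le_abs_x)
  ultimately show ?thesis by (simp add: power_divide)
qed

text \<open>
  The Fejer-Korovkin kernel: a multiple of \<open>\<bar>\<Sum> b\<^sub>k e\<^sup>i\<^sup>k\<^sup>s\<bar>\<^sup>2\<close>, hence nonnegative, where the \<open>b\<^sub>k\<close> are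
  chosen so as to bring the ratio of the first Fourier coefficient to the mean as close to one as the
  number of terms permits. That closeness is what concentrates the kernel at scale \<open>1 / m\<close>.
\<close>

definition jackson_kernel :: "nat \<Rightarrow> real \<Rightarrow> real" where
  "jackson_kernel m s =
     (let b = (\<lambda>k. sin (real k * (pi / real (m + 1)))) in
      (\<Sum>j\<le>m. \<Sum>k\<le>m. b j * b k * cos (of_int (int j - int k) * s)) / (2 * pi * (\<Sum>k\<le>m. (b k)\<^sup>2)))"

lemma jackson_kernel_continuous [continuous_intros]:
  fixes f :: "'a::t2_space \<Rightarrow> real"
  assumes "continuous_on S f"
  shows "continuous_on S (\<lambda>x. jackson_kernel m (f x))"
  unfolding jackson_kernel_def Let_def divide_inverse by (intro continuous_intros assms)

lemma jackson_kernel_nonneg: "0 \<le> jackson_kernel m s"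
proof -
  have "0 \<le> (\<Sum>j\<le>m. b j * cos (j * s))\<^sup>2 + (\<Sum>j\<le>m. b j * sin (j * s))\<^sup>2" for b :: "nat \<Rightarrow> real"
    by simp
  also have "(\<Sum>j\<le>m. b j * cos (j * s))\<^sup>2 + (\<Sum>j\<le>m. b j * sin (j * s))\<^sup>2
      = (\<Sum>j\<le>m. \<Sum>k\<le>m. b j * b k * cos (of_int (int j - int k) * s))" for b :: "nat \<Rightarrow> real"
    unfolding power2_eq_square sum_product sum.distrib[symmetric]
    by (simp add: left_diff_distrib cos_diff algebra_simps)
  finally have "0 \<le> (\<Sum>j\<le>m. \<Sum>k\<le>m. b j * b k * cos (of_int (int j - int k) * s))"
    for b :: "nat \<Rightarrow> real" .
  then show ?thesis
    unfolding jackson_kernel_def Let_def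
    by (intro divide_nonneg_nonneg mult_nonneg_nonneg[OF _ sum_nonneg]) auto
qed

lemma jackson_kernel_minus: "jackson_kernel m (- s) = jackson_kernel m s"
  unfolding jackson_kernel_def by simp

text \<open>
  Integration of the double sum leaves the diagonal in the first case and the two neighbouring
  diagonals in the second, where the identity for consecutive sines evaluates them.
\<close>
lemma jackson_kernel_moments:
  assumes "m \<ge> 1"
  shows "integral {-pi..pi} (jackson_kernel m) = 1"
    and "integral {-pi..pi} (\<lambda>s. cos s * jackson_kernel m s) = cos (pi / real (m + 1))"
proof -
  define x where "x = pi / real (m + 1)"
  define b where "b = (\<lambda>k::nat. sin (real k * x))"
  define B where "B = (\<Sum>k\<le>m. (b k)\<^sup>2)"
  have "0 < x" "x < pi"
    using assms by (auto simp: x_def field_simps)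
  then have "0 < (b 1)\<^sup>2"
    using sin_gt_zero[of x] by (simp add: b_def)
  also have "\<dots> \<le> B"
    unfolding B_def using assms by (intro member_le_sum) auto
  finally have B: "B > 0" .
  have J: "jackson_kernel m s
      = (\<Sum>j\<le>m. \<Sum>k\<le>m. b j * b k * cos (of_int (int j - int k) * s)) / (2 * pi * B)" for s
    unfolding jackson_kernel_def b_def B_def x_def Let_def ..
  have "integral {-pi..pi} (jackson_kernel m)
      = (\<Sum>j\<le>m. \<Sum>k\<le>m. b j * b k * integral {-pi..pi} (\<lambda>s. cos (of_int (int j - int k) * s))) / (2 * pi * B)"
    unfolding J
    by (simp add: integral_sum integrable_continuous_real continuous_intros del: of_int_diff)
  also have "\<dots> = (\<Sum>j\<le>m. \<Sum>k\<le>m. if k = j then b j * b k * (2 * pi) else 0) / (2 * pi * B)"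
    unfolding integral_cos_int by (intro arg_cong2[where f = "(/)"] sum.cong refl) auto
  also have "\<dots> = 1"
    using B by (simp add: B_def power2_eq_square flip: sum_distrib_right)
  finally show "integral {-pi..pi} (jackson_kernel m) = 1" .
  have c: "cos s * cos (of_int d * s) = (cos (of_int (d + 1) * s) + cos (of_int (d - 1) * s)) / 2"
    for s :: real and d
    by (simp add: distrib_right left_diff_distrib cos_add cos_diff)
  have "(\<lambda>s. cos s * jackson_kernel m s) = (\<lambda>s. (\<Sum>j\<le>m. \<Sum>k\<le>m. b j * b k *
      ((cos (of_int (int j - int k + 1) * s) + cos (of_int (int j - int k - 1) * s)) / 2)) / (2 * pi * B))"
    unfolding J c[symmetric] by (simp add: sum_distrib_left mult_ac)
  then have "integral {-pi..pi} (\<lambda>s. cos s * jackson_kernel m s)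
      = (\<Sum>j\<le>m. \<Sum>k\<le>m. b j * b k *
      ((integral {-pi..pi} (\<lambda>s. cos (of_int (int j - int k + 1) * s))
        + integral {-pi..pi} (\<lambda>s. cos (of_int (int j - int k - 1) * s))) / 2)) / (2 * pi * B)"
    by (simp add: integral_sum integral_add integrable_continuous_real continuous_intros
        del: of_int_diff of_int_add)
  also have "\<dots> = (\<Sum>j\<le>m. \<Sum>k\<le>m. (if k = Suc j then b j * b k * pi else 0)
      + (if j = Suc k then b k * b j * pi else 0)) / (2 * pi * B)"
    unfolding integral_cos_int by (intro arg_cong2[where f = "(/)"] sum.cong refl) auto
  also have "\<dots> = ((\<Sum>j\<le>m. \<Sum>k\<le>m. (if k = Suc j then b j * b k * pi else 0))
      + (\<Sum>k\<le>m. \<Sum>j\<le>m. (if j = Suc k then b k * b j * pi else 0))) / (2 * pi * B)"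
    unfolding sum.distrib by (subst (2) sum.swap) simp
  also have "\<dots> = 2 * (\<Sum>j\<le>m. \<Sum>k\<le>m. (if k = Suc j then b j * b k * pi else 0)) / (2 * pi * B)"
    unfolding mult_2 ..
  also have "(\<Sum>j\<le>m. \<Sum>k\<le>m. (if k = Suc j then b j * b k * pi else 0)) = (\<Sum>j\<le>m. b j * b (Suc j) * pi)"
  proof (intro sum.cong refl)
    fix j assume "j \<in> {..m}"
    show "(\<Sum>k\<le>m. (if k = Suc j then b j * b k * pi else 0)) = b j * b (Suc j) * pi"
    proof (cases "j = m")
      case True
      then have "b (Suc j) = 0"
        by (simp add: b_def x_def)
      then show ?thesis by auto
    qed (use \<open>j \<in> {..m}\<close> in auto)
  qed
  also have "(\<Sum>j\<le>m. b j * b (Suc j) * pi) = cos x * B * pi"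
    using sum_sin_consecutive[OF x_def] by (simp add: b_def B_def flip: sum_distrib_right)
  also have "2 * (cos x * B * pi) / (2 * pi * B) = cos x"
    using B by simp
  finally show "integral {-pi..pi} (\<lambda>s. cos s * jackson_kernel m s) = cos (pi / real (m + 1))"
    unfolding x_def .
qed

text \<open>
  On a period \<open>s\<^sup>2\<close> is dominated by \<open>1 - cos s\<close>, and the mean of the latter is
  \<open>1 - cos (pi / (m + 1))\<close>, of order \<open>m\<^sup>-\<^sup>2\<close>.
\<close>
lemma jackson_kernel_second_moment:
  assumes "m \<ge> 1"
  shows "integral {-pi..pi} (\<lambda>s. s\<^sup>2 * jackson_kernel m s) \<le> 60 / (real m)\<^sup>2"
proof -
  have int: "f integrable_on {-pi..pi}" if "continuous_on {-pi..pi} f" for f :: "real \<Rightarrow> real"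
    using that by (rule integrable_continuous_real)
  have "integral {-pi..pi} (\<lambda>s. s\<^sup>2 * jackson_kernel m s)
      \<le> integral {-pi..pi} (\<lambda>s. 12 * (jackson_kernel m s - cos s * jackson_kernel m s))"
  proof (intro integral_le int continuous_intros)
    fix s assume "s \<in> {-pi..pi}"
    then have "s\<^sup>2 * jackson_kernel m s \<le> (12 * (1 - cos s)) * jackson_kernel m s"
      by (intro mult_right_mono power2_le_one_minus_cos jackson_kernel_nonneg) (auto simp: abs_le_iff)
    then show "s\<^sup>2 * jackson_kernel m s \<le> 12 * (jackson_kernel m s - cos s * jackson_kernel m s)"
      by (simp add: algebra_simps)
  qed
  also have "\<dots> = 12 * (1 - cos (pi / real (m + 1)))"
    using jackson_kernel_moments[OF assms]
    by (simp add: integral_diff int continuous_intros)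
  also have "\<dots> \<le> 12 * ((pi / real (m + 1))\<^sup>2 / 2)"
    using one_minus_cos_le by (intro mult_left_mono) auto
  also have "\<dots> = 6 * pi\<^sup>2 / (real (m + 1))\<^sup>2"
    by (simp add: power_divide)
  also have "\<dots> \<le> 60 / (real m)\<^sup>2"
  proof (intro frac_le)
    have "pi\<^sup>2 \<le> (3.15)\<^sup>2" using pi_approx by (intro power_mono) auto
    then show "6 * pi\<^sup>2 \<le> 60" by (simp add: power2_eq_square)
  qed (use assms in auto)
  finally show ?thesis .
qed

text \<open>
  The approximant is the convolution with the kernel. The first order Taylor term drops out because
  the kernel is even, so that the error is governed by the second moment; the derivative of the
  convolution is the convolution of the derivative. The second order rate matters: it makes the
  degrees summable in the multiscale construction below.
\<close>

lemma jackson_approximation: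
  fixes H H' :: "real \<Rightarrow> real"
  assumes per: "\<And>t. H (t + 2 * pi) = H t"
    and der: "\<And>t. DERIV H t :> H' t"
    and lip: "\<And>s t. \<bar>H' s - H' t\<bar> \<le> L * \<bar>s - t\<bar>"
    and m: "m \<ge> 1"
  obtains P P' where
    "trig_poly m (\<lambda>t. complex_of_real (P t))"
    "\<And>t. DERIV P t :> P' t"
    "\<And>t. \<bar>P t - H t\<bar> \<le> 60 * L / (real m)\<^sup>2"
    "\<And>t. \<bar>P' t - H' t\<bar> \<le> 31 * L / real m"
proof -
  let ?J = "jackson_kernel m"
  define P where "P = (\<lambda>t. integral {-pi..pi} (\<lambda>s. H (t - s) * ?J s))"
  define P' where "P' = (\<lambda>t. integral {-pi..pi} (\<lambda>s. H' (t - s) * ?J s))"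
  have L: "L \<ge> 0"
    using lip[of 0 1] by simp
  have "continuous_on UNIV H"
    using der DERIV_continuous_on has_field_derivative_at_within by blast
  then have contH [continuous_intros]: "continuous_on S (\<lambda>x. H (f x))" if "continuous_on S f"
    for f :: "'a::t2_space \<Rightarrow> real" and S
    using continuous_on_compose2 that by blast
  have "L-lipschitz_on UNIV H'"
    using L lip by (auto simp: lipschitz_on_def dist_real_def)
  then have contH' [continuous_intros]: "continuous_on S (\<lambda>x. H' (f x))" if "continuous_on S f"
    for f :: "'a::t2_space \<Rightarrow> real" and S
    using continuous_on_compose2[OF lipschitz_on_continuous_on] that by blast
  have int: "f integrable_on {-pi..pi}" if "continuous_on {-pi..pi} f" for f :: "real \<Rightarrow> real"
    using that by (rule integrable_continuous_real)

  \<comment> \<open>By periodicity the integration variable may be reflected, which separates \<open>t\<close> from it through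
    the addition theorem of the cosine.\<close>
  have "trig_poly m (\<lambda>t. complex_of_real (integral {-pi..pi} (\<lambda>s. H (t - s) * cos (of_int d * s))))"
    if "\<bar>d\<bar> \<le> int m" for d
  proof -
    have "integral {-pi..pi} (\<lambda>s. H (t - s) * cos (of_int d * s))
        = cos (of_int d * t) * integral {-pi..pi} (\<lambda>s. H s * cos (of_int d * s))
        + sin (of_int d * t) * integral {-pi..pi} (\<lambda>s. H s * sin (of_int d * s))" for t
    proof -
      have "cos (of_int d * (t - (x + 2 * pi))) = cos (of_int d * (t - x))" for x
        by (intro cos_eq_periodic_intro[of _ _ "- d"]) (simp add: algebra_simps)
      then have "integral {-pi..pi} (\<lambda>s. H (t - s) * cos (of_int d * (t - (t - s))))
          = integral {-pi..pi} (\<lambda>s. H s * cos (of_int d * (t - s)))"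
        by (intro integral_periodic_reflect[where f = "\<lambda>s. H s * cos (of_int d * (t - s))"]
            continuous_intros) (auto simp: per)
      also have "\<dots> = integral {-pi..pi} (\<lambda>s. cos (of_int d * t) * (H s * cos (of_int d * s))
          + sin (of_int d * t) * (H s * sin (of_int d * s)))"
        by (simp add: right_diff_distrib cos_diff algebra_simps)
      also have "\<dots> = cos (of_int d * t) * integral {-pi..pi} (\<lambda>s. H s * cos (of_int d * s))
          + sin (of_int d * t) * integral {-pi..pi} (\<lambda>s. H s * sin (of_int d * s))"
        by (simp add: integral_add int continuous_intros)
      finally show ?thesis by simp
    qed
    moreover have "trig_poly m (\<lambda>t. complex_of_real (cos (of_int d * t)) * complex_of_real a
        + complex_of_real (sin (of_int d * t)) * complex_of_real b)" for a b
      using that trig_poly_mult[OF trig_poly_cos trig_poly_const[of 0]]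
        trig_poly_mult[OF trig_poly_sin trig_poly_const[of 0]]
      by (intro trig_poly_add) auto
    ultimately show ?thesis
      by (simp only: of_real_add of_real_mult)
  qed
  note term_poly = this
  have trig: "trig_poly m (\<lambda>t. complex_of_real (P t))"
  proof -
    define b where "b = (\<lambda>k. sin (real k * (pi / real (m + 1))))"
    define B where "B = 2 * pi * (\<Sum>k\<le>m. (b k)\<^sup>2)"
    have "P t = (\<Sum>j\<le>m. \<Sum>k\<le>m. (b j * b k / B)
        * integral {-pi..pi} (\<lambda>s. H (t - s) * cos (of_int (int j - int k) * s)))" for t
    proof -
      have "P t = integral {-pi..pi} (\<lambda>s. \<Sum>j\<le>m. \<Sum>k\<le>m. (b j * b k / B)
        * (H (t - s) * cos (of_int (int j - int k) * s)))"
        unfolding P_def jackson_kernel_def Let_def b_def[symmetric] B_def[symmetric]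
        by (simp add: sum_distrib_left sum_divide_distrib mult_ac)
      also have "\<dots> = (\<Sum>j\<le>m. \<Sum>k\<le>m. integral {-pi..pi} (\<lambda>s. (b j * b k / B)
        * (H (t - s) * cos (of_int (int j - int k) * s))))"
        by (subst integral_sum, simp, intro int continuous_intros,
            intro sum.cong refl integral_sum, simp, intro int continuous_intros)
      finally show ?thesis by simp
    qed
    moreover have "trig_poly m (\<lambda>t. \<Sum>j\<le>m. \<Sum>k\<le>m. complex_of_real (b j * b k / B)
        * complex_of_real (integral {-pi..pi} (\<lambda>s. H (t - s) * cos (of_int (int j - int k) * s))))"
      using trig_poly_mult[OF trig_poly_const[of 0] term_poly]
      by (intro trig_poly_sum) (auto simp del: of_int_diff of_real_mult of_real_divide)
    ultimately show ?thesis by simp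
  qed

  have deriv: "DERIV P t :> P' t" for t
    unfolding P_def P'_def
  proof (rule leibniz_rule_field_derivative[of UNIV "-pi" pi, simplified])
    show "((\<lambda>x. H (x - s) * ?J s) has_real_derivative H' (x - s) * ?J s) (at x)" for x s
      by (auto intro!: derivative_eq_intros DERIV_chain'[OF _ der])
    show "(\<lambda>s. H (x - s) * ?J s) integrable_on {-pi..pi}" for x
      by (intro int continuous_intros)
    show "continuous_on (UNIV \<times> {-pi..pi}) (\<lambda>(x, s). H' (x - s) * ?J s)"
      by (auto simp: case_prod_beta intro!: continuous_intros)
  qed

  have mass: "integral {-pi..pi} ?J = 1" and
    second: "integral {-pi..pi} (\<lambda>s. s\<^sup>2 * ?J s) \<le> 60 / (real m)\<^sup>2"
    using jackson_kernel_moments(1)[OF m] jackson_kernel_second_moment[OF m] by auto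
  have mean: "integral {-pi..pi} (\<lambda>s. s * ?J s) = 0"
  proof -
    have "integral {-pi..- (- pi)} (\<lambda>s. (- s) * ?J (- s)) = integral {-pi..pi} (\<lambda>s. s * ?J s)"
      by (rule Henstock_Kurzweil_Integration.integral_reflect_real[where f = "\<lambda>s. s * ?J s"])
    then have "- integral {-pi..pi} (\<lambda>s. s * ?J s) = integral {-pi..pi} (\<lambda>s. s * ?J s)"
      by (simp only: minus_minus jackson_kernel_minus mult_minus_left integral_neg)
    then show ?thesis by linarith
  qed

  have "\<bar>P t - H t\<bar> \<le> 60 * L / (real m)\<^sup>2" for t
  proof -
    have taylor: "\<bar>H (t - s) - H t + s * H' t\<bar> \<le> L * s\<^sup>2" for s
    proof -
      obtain z where z: "\<bar>z - t\<bar> \<le> \<bar>s\<bar>" "H (t - s) - H t = (t - s - t) * H' z"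
      proof (cases s "0::real" rule: linorder_cases)
        case less
        then obtain z where "t < z" "z < t - s" "H (t - s) - H t = (t - s - t) * H' z"
          using MVT2[of t "t - s" H H'] der by auto
        then show ?thesis
          using that[of z] by simp
      next
        case equal
        then show ?thesis using that[of t] by simp
      next
        case greater
        then obtain z where "t - s < z" "z < t" "H t - H (t - s) = (t - (t - s)) * H' z"
          using MVT2[of "t - s" t H H'] der by auto
        then show ?thesis
          using that[of z] by (simp add: algebra_simps)
      qed
      have "\<bar>H (t - s) - H t + s * H' t\<bar> = \<bar>s\<bar> * \<bar>H' z - H' t\<bar>"
        unfolding z(2) abs_mult[symmetric] by (simp add: algebra_simps abs_minus_commute)
      also have "\<dots> \<le> \<bar>s\<bar> * (L * \<bar>s\<bar>)"
        using lip[of z t] mult_left_mono[OF z(1) L] by (intro mult_left_mono) auto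
      finally show ?thesis by (simp add: power2_eq_square mult_ac)
    qed
    have "P t - H t = integral {-pi..pi} (\<lambda>s. (H (t - s) - H t + s * H' t) * ?J s)"
    proof -
      have "integral {-pi..pi} (\<lambda>s. (H (t - s) - H t + s * H' t) * ?J s)
          = integral {-pi..pi} (\<lambda>s. H (t - s) * ?J s - H t * ?J s + H' t * (s * ?J s))"
        by (simp add: algebra_simps)
      also have "\<dots> = P t - H t * integral {-pi..pi} ?J + H' t * integral {-pi..pi} (\<lambda>s. s * ?J s)"
        unfolding P_def by (simp add: integral_add integral_diff int continuous_intros)
      finally show ?thesis using mass mean by simp
    qed
    also have "\<bar>\<dots>\<bar> \<le> integral {-pi..pi} (\<lambda>s. L * (s\<^sup>2 * ?J s))"
    proof (subst real_norm_def[symmetric], rule integral_norm_bound_integral)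
      fix s :: real assume "s \<in> {-pi..pi}"
      show "norm ((H (t - s) - H t + s * H' t) * ?J s) \<le> L * (s\<^sup>2 * ?J s)"
        using mult_right_mono[OF taylor[of s] jackson_kernel_nonneg[of m s]]
        by (simp add: abs_mult jackson_kernel_nonneg mult.assoc)
    qed (intro int continuous_intros)+
    also have "\<dots> \<le> L * (60 / (real m)\<^sup>2)"
      using second L by (subst integral_mult_right) (intro mult_left_mono, auto)
    finally show ?thesis by (simp add: mult.commute)
  qed
  moreover have "\<bar>P' t - H' t\<bar> \<le> 31 * L / real m" for t
  proof -
    \<comment> \<open>The first absolute moment of the kernel is bounded through
      \<open>2\<bar>s\<bar> \<le> m s\<^sup>2 + 1 / m\<close>.\<close>
    have am_gm: "\<bar>s\<bar> \<le> real m / 2 * s\<^sup>2 + 1 / (2 * real m)" for s :: real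
    proof -
      have "0 \<le> (real m * \<bar>s\<bar> - 1)\<^sup>2 / (2 * real m)"
        by simp
      also have "\<dots> = real m / 2 * s\<^sup>2 + 1 / (2 * real m) - \<bar>s\<bar>"
        using m by (simp add: field_simps power2_eq_square)
      finally show ?thesis by simp
    qed
    have "P' t - H' t = integral {-pi..pi} (\<lambda>s. (H' (t - s) - H' t) * ?J s)"
    proof -
      have "integral {-pi..pi} (\<lambda>s. (H' (t - s) - H' t) * ?J s)
          = integral {-pi..pi} (\<lambda>s. H' (t - s) * ?J s - H' t * ?J s)"
        by (simp add: algebra_simps)
      also have "\<dots> = P' t - H' t * integral {-pi..pi} ?J"
        unfolding P'_def by (simp add: integral_diff int continuous_intros)
      finally show ?thesis using mass by simp
    qed
    also have "\<bar>\<dots>\<bar> \<le> integral {-pi..pi} (\<lambda>s. L * (real m / 2 * (s\<^sup>2 * ?J s) + 1 / (2 * real m) * ?J s))"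
    proof (subst real_norm_def[symmetric], rule integral_norm_bound_integral)
      fix s :: real assume "s \<in> {-pi..pi}"
      have "\<bar>H' (t - s) - H' t\<bar> \<le> L * (real m / 2 * s\<^sup>2 + 1 / (2 * real m))"
        using lip[of "t - s" t] mult_left_mono[OF am_gm[of s] L] by simp
      from mult_right_mono[OF this jackson_kernel_nonneg[of m s]]
      show "norm ((H' (t - s) - H' t) * ?J s)
          \<le> L * (real m / 2 * (s\<^sup>2 * ?J s) + 1 / (2 * real m) * ?J s)"
        by (simp only: real_norm_def abs_mult abs_of_nonneg[OF jackson_kernel_nonneg])
           (simp add: algebra_simps)
    qed (intro int continuous_intros)+
    also have "\<dots> = L * (real m / 2 * integral {-pi..pi} (\<lambda>s. s\<^sup>2 * ?J s)
        + 1 / (2 * real m) * integral {-pi..pi} ?J)"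
      by (intro integral_unique has_integral_mult_right has_integral_add integrable_integral int
          continuous_intros)
    also have "\<dots> = L * (real m / 2 * integral {-pi..pi} (\<lambda>s. s\<^sup>2 * ?J s) + 1 / (2 * real m))"
      using mass by simp
    also have "\<dots> \<le> L * (real m / 2 * (60 / (real m)\<^sup>2) + 1 / (2 * real m))"
      using second L by (intro mult_left_mono add_right_mono) auto
    also have "\<dots> = 30.5 * (L / real m)"
      using m by (simp add: field_simps power2_eq_square)
    also have "\<dots> \<le> 31 * (L / real m)"
      using L by (intro mult_right_mono) auto
    finally show ?thesis by simp
  qed
  ultimately show ?thesis
    using that trig deriv by blast
qed

section \<open>Trigonometric polynomials comparable to a slowly varying exponential\<close>

definition exp_trunc :: "nat \<Rightarrow> real \<Rightarrow> real" where
  "exp_trunc n y = (\<Sum>k<n. y ^ k / fact k)"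

lemma exp_trunc_deriv: "DERIV (exp_trunc (Suc n)) y :> exp_trunc n y"
proof (induction n)
  case (Suc n)
  have "DERIV (\<lambda>y. exp_trunc (Suc n) y + y ^ Suc n / fact (Suc n)) y
      :> exp_trunc n y + real (Suc n) * y ^ n / fact (Suc n)"
    using DERIV_pow[of "Suc n" y] by (intro DERIV_add Suc DERIV_cdivide) simp
  moreover have "real (Suc n) * y ^ n / fact (Suc n) = y ^ n / fact n"
    by (simp add: fact_Suc field_simps del: of_nat_Suc)
  ultimately show ?case
    by (simp add: exp_trunc_def)
qed (simp add: exp_trunc_def)

text \<open>
  Once the order exceeds the argument by a fixed factor, the Taylor polynomial of the exponential
  function has a small relative error even where the exponential itself is tiny.
\<close>

lemma exp_trunc_bounds:
  assumes y: "\<bar>y\<bar> \<le> a" and a: "a \<ge> 1" and n: "27 * a \<le> real n"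
  shows "exp (y - 1 / a) \<le> exp_trunc n y" "exp_trunc n y \<le> exp (y + 1 / a)"
proof -
  define e where "e = exp (- (2 * a))"
  have n0: "0 < real n"
    using n a by linarith
  obtain t where t: "\<bar>t\<bar> \<le> \<bar>y\<bar>" "exp y = exp_trunc n y + exp t / fact n * y ^ n"
    using Maclaurin_exp_le[of y n] unfolding exp_trunc_def by blast
  obtain s where "exp (real n) = (\<Sum>m<Suc n. real n ^ m / fact m) + exp s / fact (Suc n) * real n ^ Suc n"
    using Maclaurin_exp_le[of "real n" "Suc n"] by blast
  then have "real n ^ n / fact n \<le> exp (real n)"
    by (simp add: sum_nonneg)
  then have "1 / fact n \<le> exp 1 ^ n / real n ^ n"
    using n0 by (simp add: field_simps flip: exp_of_nat_mult)
  then have "exp t * \<bar>y\<bar> ^ n * (1 / fact n) \<le> exp a * a ^ n * (exp 1 ^ n / real n ^ n)"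
    using t y a by (intro mult_mono power_mono) auto
  also have "\<dots> = exp a * (a * exp 1 / real n) ^ n"
    by (simp add: power_mult_distrib power_divide)
  \<comment> \<open>Since \<open>e\<^sup>3 \<le> 27\<close>, each of the \<open>n\<close> factors is at most \<open>e\<^sup>-\<^sup>2\<close>; this outweighs both the growth
    \<open>e\<^sup>a\<close> of the remainder term and the smallness of \<open>e\<^sup>y\<close>.\<close>
  also have "\<dots> \<le> exp a * exp (- 2) ^ n"
  proof (intro mult_left_mono power_mono)
    have "exp (3::real) = exp 1 ^ 3"
      by (simp flip: exp_of_nat_mult)
    also have "exp 1 ^ 3 \<le> (3 :: real) ^ 3"
      using exp_le by (intro power_mono) auto
    finally have "exp 3 \<le> (27 :: real)" by simp
    then have "a * exp 3 \<le> a * 27"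
      using a by (intro mult_left_mono) auto
    then have "a * exp 3 \<le> real n" using n by linarith
    moreover have "exp 3 = exp 1 * exp (2::real)"
      by (simp flip: exp_add)
    ultimately show "a * exp 1 / real n \<le> exp (- 2)"
      using n0 by (simp add: exp_minus field_simps)
  qed (use a in auto)
  also have "\<dots> = exp (a - 2 * n)"
    by (simp add: exp_diff exp_minus power_inverse divide_inverse flip: exp_of_nat2_mult)
  also have "\<dots> \<le> exp (- a + - (2 * a))"
    using n a by simp
  also have "\<dots> \<le> exp (y + - (2 * a))"
    using y by simp
  also have "\<dots> = exp y * e"
    unfolding e_def exp_add ..
  finally have "\<bar>exp y - exp_trunc n y\<bar> \<le> exp y * e"
    unfolding t(2) by (simp add: abs_mult power_abs)
  then have b: "exp y * (1 - e) \<le> exp_trunc n y" "exp_trunc n y \<le> exp y * (1 + e)"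
    by (auto simp: algebra_simps abs_le_iff)
  have "2 * a \<le> exp (2 * a)"
    using exp_ge_add_one_self[of "2 * a"] by linarith
  then have e: "0 \<le> e" "e \<le> 1 / (2 * a)"
    using a by (auto simp: e_def exp_minus field_simps)
  have e2: "e \<le> 1 / 2"
    by (rule order_trans[OF e(2)]) (use a in \<open>simp add: field_simps\<close>)
  have "exp (2 * e) * (1 - e) \<ge> (1 + 2 * e) * (1 - e)"
    using exp_ge_add_one_self[of "2 * e"] e2 by (intro mult_right_mono) auto
  moreover have "(1 + 2 * e) * (1 - e) = 1 + e * (1 - 2 * e)"
    by (simp add: algebra_simps)
  moreover have "e * (1 - 2 * e) \<ge> 0"
    using e e2 by (intro mult_nonneg_nonneg) auto
  ultimately have "exp (- (2 * e)) \<le> 1 - e"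
    by (simp add: exp_minus field_simps)
  moreover have "exp (- (1 / a)) \<le> exp (- (2 * e))"
    using e a by (simp add: field_simps)
  ultimately have "exp (- (1 / a)) \<le> 1 - e"
    by linarith
  then have "exp y * exp (- (1 / a)) \<le> exp y * (1 - e)"
    by (intro mult_left_mono) auto
  then have "exp y * exp (- (1 / a)) \<le> exp_trunc n y"
    using b(1) by linarith
  then show "exp (y - 1 / a) \<le> exp_trunc n y"
    using exp_add[of y "- (1 / a)"] by simp
  have "1 + e \<le> 1 + 1 / a"
    using e a by (simp add: field_simps)
  also have "\<dots> \<le> exp (1 / a)"
    by (rule exp_ge_add_one_self)
  finally have "exp y * (1 + e) \<le> exp y * exp (1 / a)"
    by (intro mult_left_mono) auto
  then show "exp_trunc n y \<le> exp (y + 1 / a)"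
    using b(2) unfolding exp_add by linarith
qed

text \<open>
  A positive trigonometric polynomial whose logarithm is close to \<open>h\<close> and has a bounded derivative.
  All three parameters are additive under products, because accuracy and slope are measured
  logarithmically.
\<close>
definition exp_approx :: "nat \<Rightarrow> real \<Rightarrow> real \<Rightarrow> (real \<Rightarrow> real) \<Rightarrow> bool" where
  "exp_approx d s D h \<longleftrightarrow> (\<exists>q q'. trig_poly d (\<lambda>t. complex_of_real (q t)) \<and>
     (\<forall>t. DERIV q t :> q' t \<and> exp (h t - s) \<le> q t \<and> q t \<le> exp (h t + s) \<and> \<bar>q' t\<bar> \<le> D * q t))"

lemma exp_approx_add:
  assumes "exp_approx d\<^sub>1 s\<^sub>1 D\<^sub>1 h\<^sub>1" "exp_approx d\<^sub>2 s\<^sub>2 D\<^sub>2 h\<^sub>2"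
  shows "exp_approx (d\<^sub>1 + d\<^sub>2) (s\<^sub>1 + s\<^sub>2) (D\<^sub>1 + D\<^sub>2) (\<lambda>t. h\<^sub>1 t + h\<^sub>2 t)"
proof -
  obtain q\<^sub>1 q\<^sub>1' where q1: "trig_poly d\<^sub>1 (\<lambda>t. complex_of_real (q\<^sub>1 t))"
    "\<And>t. DERIV q\<^sub>1 t :> q\<^sub>1' t" "\<And>t. exp (h\<^sub>1 t - s\<^sub>1) \<le> q\<^sub>1 t" "\<And>t. q\<^sub>1 t \<le> exp (h\<^sub>1 t + s\<^sub>1)"
    "\<And>t. \<bar>q\<^sub>1' t\<bar> \<le> D\<^sub>1 * q\<^sub>1 t"
    using assms(1) unfolding exp_approx_def by blast
  obtain q\<^sub>2 q\<^sub>2' where q2: "trig_poly d\<^sub>2 (\<lambda>t. complex_of_real (q\<^sub>2 t))"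
    "\<And>t. DERIV q\<^sub>2 t :> q\<^sub>2' t" "\<And>t. exp (h\<^sub>2 t - s\<^sub>2) \<le> q\<^sub>2 t" "\<And>t. q\<^sub>2 t \<le> exp (h\<^sub>2 t + s\<^sub>2)"
    "\<And>t. \<bar>q\<^sub>2' t\<bar> \<le> D\<^sub>2 * q\<^sub>2 t"
    using assms(2) unfolding exp_approx_def by blast
  have pos: "0 < q\<^sub>1 t" "0 < q\<^sub>2 t" for t
    using q1(3)[of t] q2(3)[of t] exp_gt_zero less_le_trans by blast+
  show ?thesis
    unfolding exp_approx_def
  proof (intro exI conjI allI)
    show "trig_poly (d\<^sub>1 + d\<^sub>2) (\<lambda>t. complex_of_real (q\<^sub>1 t * q\<^sub>2 t))"
      using trig_poly_mult[OF q1(1) q2(1)] by simp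
    fix t
    show "DERIV (\<lambda>t. q\<^sub>1 t * q\<^sub>2 t) t :> q\<^sub>1' t * q\<^sub>2 t + q\<^sub>2' t * q\<^sub>1 t"
      by (intro DERIV_mult q1 q2)
    show "exp (h\<^sub>1 t + h\<^sub>2 t - (s\<^sub>1 + s\<^sub>2)) \<le> q\<^sub>1 t * q\<^sub>2 t"
      using mult_mono[OF q1(3)[of t] q2(3)[of t]] pos[of t]
      by (simp add: algebra_simps flip: exp_add)
    show "q\<^sub>1 t * q\<^sub>2 t \<le> exp (h\<^sub>1 t + h\<^sub>2 t + (s\<^sub>1 + s\<^sub>2))"
      using mult_mono[OF q1(4)[of t] q2(4)[of t]] pos[of t]
      by (simp add: algebra_simps flip: exp_add)
    have "\<bar>q\<^sub>1' t * q\<^sub>2 t + q\<^sub>2' t * q\<^sub>1 t\<bar> \<le> \<bar>q\<^sub>1' t\<bar> * q\<^sub>2 t + \<bar>q\<^sub>2' t\<bar> * q\<^sub>1 t"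
      using pos[of t] abs_triangle_ineq[of "q\<^sub>1' t * q\<^sub>2 t" "q\<^sub>2' t * q\<^sub>1 t"] by (simp add: abs_mult)
    also have "\<dots> \<le> (D\<^sub>1 * q\<^sub>1 t) * q\<^sub>2 t + (D\<^sub>2 * q\<^sub>2 t) * q\<^sub>1 t"
      using pos[of t] q1(5)[of t] q2(5)[of t] by (intro add_mono mult_right_mono) auto
    finally show "\<bar>q\<^sub>1' t * q\<^sub>2 t + q\<^sub>2' t * q\<^sub>1 t\<bar> \<le> (D\<^sub>1 + D\<^sub>2) * (q\<^sub>1 t * q\<^sub>2 t)"
      by (simp add: algebra_simps)
  qed
qed

lemma exp_approx_sum:
  fixes J :: nat
  assumes "\<And>k. k \<le> J \<Longrightarrow> exp_approx (d k) (s k) (D k) (h k)"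
  shows "exp_approx (\<Sum>k\<le>J. d k) (\<Sum>k\<le>J. s k) (\<Sum>k\<le>J. D k) (\<lambda>t. \<Sum>k\<le>J. h k t)"
  using assms
proof (induction J)
  case (Suc J)
  then have "exp_approx (\<Sum>k\<le>J. d k) (\<Sum>k\<le>J. s k) (\<Sum>k\<le>J. D k) (\<lambda>t. \<Sum>k\<le>J. h k t)"
    by simp
  from exp_approx_add[OF this Suc.prems[of "Suc J"]] show ?case
    by simp
qed simp

text \<open>
  Composition with a Taylor polynomial of the exponential function, of order proportional to the
  size of the exponent. The derivative of the composition involves the Taylor polynomial of the next
  lower order, which is comparable to it.
\<close>
lemma exp_approx_trig_poly:
  assumes trig: "trig_poly d (\<lambda>t. complex_of_real (y t))"
    and der: "\<And>t. DERIV y t :> y' t"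
    and a: "\<And>t. \<bar>y t\<bar> \<le> a" "a \<ge> 1" and b: "\<And>t. \<bar>y' t\<bar> \<le> b"
    and n: "27 * a \<le> real n"
  shows "exp_approx (n * d) (1 / a) (9 * b) y"
  unfolding exp_approx_def
proof (intro exI conjI allI)
  have "trig_poly (n * d) (\<lambda>t. \<Sum>k<Suc n. complex_of_real (1 / fact k) * complex_of_real (y t) ^ k)"
  proof (rule trig_poly_sum)
    fix k assume "k \<in> {..<Suc n}"
    then show "trig_poly (n * d) (\<lambda>t. complex_of_real (1 / fact k) * complex_of_real (y t) ^ k)"
      using trig_poly_mult[OF trig_poly_const[of 0 "complex_of_real (1 / fact k)"] trig_poly_power[OF trig, of k]]
      by (intro trig_poly_mono[of "0 + k * d" _ "n * d"]) auto
  qed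
  then show "trig_poly (n * d) (\<lambda>t. complex_of_real (exp_trunc (Suc n) (y t)))"
    by (simp add: exp_trunc_def)
  fix t
  show "DERIV (\<lambda>t. exp_trunc (Suc n) (y t)) t :> exp_trunc n (y t) * y' t"
    by (rule DERIV_chain2[OF exp_trunc_deriv der])
  have up: "exp_trunc n (y t) \<le> exp (y t + 1 / a)"
    and low: "exp (y t - 1 / a) \<le> exp_trunc n (y t)"
    by (rule exp_trunc_bounds[OF a(1) a(2) n])+
  show low': "exp (y t - 1 / a) \<le> exp_trunc (Suc n) (y t)"
    and "exp_trunc (Suc n) (y t) \<le> exp (y t + 1 / a)"
    using n by (intro exp_trunc_bounds[OF a(1) a(2)]; simp)+
  have "exp (y t + 1 / a) \<le> exp (2 + (y t - 1 / a))"
    using a(2) by (simp add: field_simps)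
  also have "\<dots> = exp 1 * exp 1 * exp (y t - 1 / a)"
    by (simp flip: exp_add)
  also have "\<dots> \<le> 3 * 3 * exp_trunc (Suc n) (y t)"
    using low' exp_le by (intro mult_mono) auto
  finally have "exp_trunc n (y t) \<le> 9 * exp_trunc (Suc n) (y t)"
    using up by linarith
  moreover have "0 < exp_trunc n (y t)"
    using low exp_gt_zero less_le_trans by blast
  moreover have "0 \<le> b"
    using b[of t] by linarith
  ultimately have "exp_trunc n (y t) * \<bar>y' t\<bar> \<le> (9 * exp_trunc (Suc n) (y t)) * b"
    using b[of t] by (intro mult_mono) auto
  then show "\<bar>exp_trunc n (y t) * y' t\<bar> \<le> 9 * b * exp_trunc (Suc n) (y t)"
    using \<open>0 < exp_trunc n (y t)\<close> by (simp add: abs_mult mult_ac)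
qed

lemma exp_approx_perturb:
  assumes "exp_approx d s D h" "\<And>t. \<bar>h t - h' t\<bar> \<le> e" "s + e \<le> s'" "D \<le> D'"
  shows "exp_approx d s' D' h'"
proof -
  obtain q q' where q: "trig_poly d (\<lambda>t. complex_of_real (q t))"
    "\<And>t. DERIV q t :> q' t" "\<And>t. exp (h t - s) \<le> q t" "\<And>t. q t \<le> exp (h t + s)"
    "\<And>t. \<bar>q' t\<bar> \<le> D * q t"
    using assms(1) unfolding exp_approx_def by blast
  have "exp (h' t - s') \<le> q t" "q t \<le> exp (h' t + s')" for t
    using q(3,4)[of t] assms(2)[of t] assms(3)
    by (smt (verit) exp_le_cancel_iff)+
  moreover have "\<bar>q' t\<bar> \<le> D' * q t" for t
  proof -
    have "D * q t \<le> D' * q t"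
      using assms(4) q(3)[of t] exp_gt_zero[of "h t - s"] by (intro mult_right_mono) linarith+
    then show ?thesis using q(5)[of t] by linarith
  qed
  ultimately show ?thesis
    unfolding exp_approx_def using q(1,2) by blast
qed

lemma sum_half_powers: "(\<Sum>k\<le>J. 1 / 2 ^ k) \<le> (2 :: real)"
proof -
  have "(\<Sum>k\<le>J. 1 / 2 ^ k) = (2 - 1 / 2 ^ J :: real)"
    by (induction J) (auto simp: field_simps)
  then show ?thesis by simp
qed

text \<open>
  Think of \<open>M\<close> as large. To replace \<open>H\<close> by a single Jackson approximant with error of order one
  takes degree \<open>m M\<^sup>1\<^sup>/\<^sup>2\<close>, and exponentiating it multiplies the degree by \<open>M\<close>: too much. Instead
  \<open>H\<close> is telescoped into the differences \<open>y\<^sub>k\<close> of consecutive approximants of degrees \<open>2\<^sup>k m\<close>. The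
  \<open>k\<close>-th difference has size \<open>M 4\<^sup>-\<^sup>k\<close>, so a Taylor polynomial of order proportional to \<open>M 4\<^sup>-\<^sup>k\<close>
  exponentiates it at the cost of degree \<open>M 4\<^sup>-\<^sup>k 2\<^sup>k m\<close>, and these degrees sum up to a multiple of
  \<open>M m\<close>. The slopes are of order \<open>M m 2\<^sup>-\<^sup>k\<close> and sum up in the same way.
\<close>
lemma exp_approx_slowly_varying:
  fixes H H' :: "real \<Rightarrow> real"
  assumes per: "\<And>t. H (t + 2 * pi) = H t"
    and der: "\<And>t. DERIV H t :> H' t"
    and bound: "\<And>t. \<bar>H t\<bar> \<le> M" "\<And>t. \<bar>H' t\<bar> \<le> M * real m"
    and lip: "\<And>s t. \<bar>H' s - H' t\<bar> \<le> M * (real m)\<^sup>2 * \<bar>s - t\<bar>"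
    and M: "M \<ge> 1" and m: "m \<ge> 1"
  obtains d where "real d \<le> 67200 * (M * real m)" "exp_approx d 3 (1674 * (M * real m)) (\<lambda>t. - H t)"
proof -
  have "\<exists>P P'. trig_poly (m * 2 ^ k) (\<lambda>t. complex_of_real (P t)) \<and> (\<forall>t. DERIV P t :> P' t) \<and>
      (\<forall>t. \<bar>P t - H t\<bar> \<le> 60 * M / 4 ^ k) \<and> (\<forall>t. \<bar>P' t - H' t\<bar> \<le> 31 * (M * real m) / 2 ^ k)" for k
  proof -
    have "m * 2 ^ k \<ge> 1"
      using m by simp
    then obtain P P' where P: "trig_poly (m * 2 ^ k) (\<lambda>t. complex_of_real (P t))"
      "\<And>t. DERIV P t :> P' t"
      "\<And>t. \<bar>P t - H t\<bar> \<le> 60 * (M * (real m)\<^sup>2) / (real (m * 2 ^ k))\<^sup>2"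
      "\<And>t. \<bar>P' t - H' t\<bar> \<le> 31 * (M * (real m)\<^sup>2) / real (m * 2 ^ k)"
      using jackson_approximation[OF per der lip] by metis
    have "(2 ^ k)\<^sup>2 = (4 ^ k :: real)"
      by (simp flip: power_mult_distrib power_mult add: power2_eq_square)
    then have "60 * (M * (real m)\<^sup>2) / (real (m * 2 ^ k))\<^sup>2 = 60 * M / 4 ^ k"
      "31 * (M * (real m)\<^sup>2) / real (m * 2 ^ k) = 31 * (M * real m) / 2 ^ k"
      using m by (auto simp: power_mult_distrib power2_eq_square)
    then show ?thesis
      using P by auto
  qed
  then obtain P P' where P: "\<And>k. trig_poly (m * 2 ^ k) (\<lambda>t. complex_of_real (P k t))"
      "\<And>k t. DERIV (P k) t :> P' k t"
      "\<And>k t. \<bar>P k t - H t\<bar> \<le> 60 * M / 4 ^ k"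
      "\<And>k t. \<bar>P' k t - H' t\<bar> \<le> 31 * (M * real m) / 2 ^ k"
    by metis
  \<comment> \<open>The telescoping stops as soon as the remaining error is of order one. Rounding \<open>300 M\<close> up to
    the power \<open>4\<^sup>J\<close> makes the orders of the Taylor polynomials the integers \<open>28 * 4 ^ (J - k)\<close>.\<close>
  define J where "J = nat \<lceil>log 4 (300 * M)\<rceil>"
  have J: "300 * M \<le> 4 ^ J" "4 ^ J \<le> 1200 * M"
  proof -
    have l: "0 \<le> log 4 (300 * M)"
      using M by (subst zero_le_log_cancel_iff) auto
    then have "log 4 (300 * M) \<le> real J" "real J \<le> log 4 (300 * M) + 1"
      unfolding J_def by linarith+
    then have "4 powr (log 4 (300 * M)) \<le> 4 powr real J" "4 powr real J \<le> 4 powr (log 4 (300 * M) + 1)"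
      by auto
    then show "300 * M \<le> 4 ^ J" "4 ^ J \<le> 1200 * M"
      using M by (auto simp: powr_realpow powr_add)
  qed
  define y where "y = (\<lambda>k t. if k = 0 then - P 0 t else P (k - 1) t - P k t)"
  define y' where "y' = (\<lambda>k t. if k = 0 then - P' 0 t else P' (k - 1) t - P' k t)"
  have approx: "exp_approx (28 * 4 ^ (J - k) * (m * 2 ^ k)) (1 / 4 ^ (J - k)) (9 * (93 * (M * real m) / 2 ^ k)) (y k)"
    if k: "k \<le> J" for k
  proof (rule exp_approx_trig_poly)
    have minus: "trig_poly (m * 2 ^ k) (\<lambda>t. (- 1) * complex_of_real (P k t))"
      using trig_poly_mult[OF trig_poly_const[of 0 "- 1"] P(1)[of k]] by simp
    have "trig_poly (m * 2 ^ k) (\<lambda>t. complex_of_real (P (k - 1) t))"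
      by (rule trig_poly_mono[OF P(1)]) (auto intro: power_increasing)
    with minus show "trig_poly (m * 2 ^ k) (\<lambda>t. complex_of_real (y k t))"
      using trig_poly_add[of "m * 2 ^ k" "\<lambda>t. complex_of_real (P (k - 1) t)"
          "\<lambda>t. (- 1) * complex_of_real (P k t)"]
      by (cases "k = 0") (auto simp: y_def)
    show "DERIV (y k) t :> y' k t" for t
      unfolding y_def y'_def by (auto intro!: derivative_eq_intros P)
    have "300 * M / 4 ^ k \<le> 4 ^ J / 4 ^ k"
      using J by (intro divide_right_mono) auto
    also have "\<dots> = 4 ^ (J - k)"
      using k by (simp add: power_diff)
    finally have a: "300 * M / 4 ^ k \<le> 4 ^ (J - k)" .
    show "\<bar>y k t\<bar> \<le> 4 ^ (J - k)" for t
    proof (cases k)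
      case 0
      then show ?thesis
        using P(3)[of 0 t] bound(1)[of t] a M by (simp add: y_def)
    next
      case (Suc i)
      then have "\<bar>y k t\<bar> \<le> 60 * M / 4 ^ i + 60 * M / 4 ^ Suc i"
        using P(3)[of i t] P(3)[of "Suc i" t] by (simp add: y_def)
      also have "\<dots> = 300 * M / 4 ^ k"
        using Suc by simp
      finally show ?thesis using a by simp
    qed
    show "\<bar>y' k t\<bar> \<le> 93 * (M * real m) / 2 ^ k" for t
    proof (cases k)
      case 0
      then show ?thesis
        using P(4)[of 0 t] bound(2)[of t] by (simp add: y'_def)
    next
      case (Suc i)
      then have "\<bar>y' k t\<bar> \<le> 31 * (M * real m) / 2 ^ i + 31 * (M * real m) / 2 ^ Suc i"
        using P(4)[of i t] P(4)[of "Suc i" t] by (simp add: y'_def)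
      also have "\<dots> = 93 * (M * real m) / 2 ^ k"
        using Suc by simp
      finally show ?thesis .
    qed
  qed auto
  define d where "d = (\<Sum>k\<le>J. 28 * 4 ^ (J - k) * (m * 2 ^ k))"
  have "real d = (\<Sum>k\<le>J. 28 * real m * 4 ^ J * (1 / 2 ^ k))"
    unfolding d_def of_nat_sum
  proof (intro sum.cong refl)
    fix k assume "k \<in> {..J}"
    then have "real (4 ^ (J - k)) = 4 ^ J / 4 ^ k"
      by (subst of_nat_power) (simp add: power_diff)
    moreover have "(4::real) ^ k = 2 ^ k * 2 ^ k"
      by (simp flip: power_mult_distrib)
    ultimately show "real (28 * 4 ^ (J - k) * (m * 2 ^ k)) = 28 * real m * 4 ^ J * (1 / 2 ^ k)"
      by (simp only: of_nat_mult) (simp add: field_simps)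
  qed
  also have "\<dots> \<le> 28 * real m * 4 ^ J * 2"
    unfolding sum_distrib_left[symmetric] by (intro mult_left_mono sum_half_powers) auto
  also have "\<dots> \<le> 28 * real m * (1200 * M) * 2"
    using J by (intro mult_left_mono mult_right_mono) auto
  finally have deg: "real d \<le> 67200 * (M * real m)"
    by (simp add: mult_ac)
  have "exp_approx d (\<Sum>k\<le>J. 1 / 4 ^ (J - k)) (\<Sum>k\<le>J. 9 * (93 * (M * real m) / 2 ^ k)) (\<lambda>t. \<Sum>k\<le>J. y k t)"
    unfolding d_def using approx by (rule exp_approx_sum)
  moreover have "(\<Sum>k\<le>J. y k t) = - P J t" for t
    by (induction J) (auto simp: y_def)
  ultimately have "exp_approx d (\<Sum>k\<le>J. 1 / 4 ^ (J - k)) (\<Sum>k\<le>J. 9 * (93 * (M * real m) / 2 ^ k)) (\<lambda>t. - P J t)"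
    by simp
  then have "exp_approx d 3 (1674 * (M * real m)) (\<lambda>t. - H t)"
  proof (rule exp_approx_perturb)
    show "\<bar>- P J t - - H t\<bar> \<le> 1" for t
    proof -
      have "60 * M / 4 ^ J \<le> 1"
        using J M by (simp add: field_simps)
      then show ?thesis using P(3)[of J t] by linarith
    qed
    have "(\<Sum>k\<le>J. 1 / 4 ^ (J - k)) = (\<Sum>k\<le>J. 1 / (4::real) ^ k)"
      using sum.nat_diff_reindex[of "\<lambda>k. 1 / (4::real) ^ k" "Suc J"] by (simp add: lessThan_Suc_atMost)
    also have "\<dots> \<le> (\<Sum>k\<le>J. 1 / 2 ^ k)"
      by (intro sum_mono frac_le power_mono) auto
    also have "\<dots> \<le> 2" by (rule sum_half_powers)
    finally show "(\<Sum>k\<le>J. 1 / 4 ^ (J - k)) + 1 \<le> (3 :: real)" by simp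
    have "(\<Sum>k\<le>J. 9 * (93 * (M * real m) / 2 ^ k)) = 837 * (M * real m) * (\<Sum>k\<le>J. 1 / 2 ^ k)"
      by (simp add: sum_distrib_left)
    also have "\<dots> \<le> 837 * (M * real m) * 2"
      using M by (intro mult_left_mono sum_half_powers) auto
    finally show "(\<Sum>k\<le>J. 9 * (93 * (M * real m) / 2 ^ k)) \<le> 1674 * (M * real m)"
      by simp
  qed
  then show ?thesis
    using that deg by blast
qed

section \<open>Flattening the exponent near its singularity\<close>

text \<open>
  The exponent as a function of the modulus of \<open>g\<close>. The class is closed under multiplication of \<open>F\<close> by
  positive constants (with the same \<open>A1\<close>, \<open>A2\<close> and \<open>K\<close>), through which the exponent \<open>p\<close> enters.
\<close>
locale singular_profile =
  fixes A A1 A2 K :: real and F f1 f2 :: "real \<Rightarrow> real"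
  assumes A: "0 < A" and A2: "0 < A2"
    and F_pos: "\<And>x. x \<in> {0<..A} \<Longrightarrow> 0 < F x"
    and F_blowup: "filterlim F at_top (at_right 0)"
    and F_deriv: "\<And>x. x \<in> {0<..A} \<Longrightarrow> (F has_real_derivative f1 x) (at x within {0<..A})"
    and f1_deriv: "\<And>x. x \<in> {0<..A} \<Longrightarrow> (f1 has_real_derivative f2 x) (at x within {0<..A})"
    and f1_lower: "\<And>x. x \<in> {0<..A} \<Longrightarrow> A2 * F x / x \<le> - f1 x"
    and f1_upper: "\<And>x. x \<in> {0<..A} \<Longrightarrow> - f1 x \<le> A1 * F x / x"
    and f2_bound: "\<And>x. x \<in> {0<..A} \<Longrightarrow> \<bar>f2 x\<bar> \<le> K * F x / x\<^sup>2"
begin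

lemma f1_neg: "x \<in> {0<..A} \<Longrightarrow> f1 x < 0"
  using f1_lower[of x] F_pos[of x] A2 by (smt (verit) divide_pos_pos greaterThanAtMost_iff mult_pos_pos)

lemma A1_pos: "0 < A1" and K_nonneg: "0 \<le> K"
proof -
  have "A \<in> {0<..A}" using A by simp
  then have "0 < A1 * F A / A" "0 \<le> K * F A / A\<^sup>2" "0 < F A"
    using f1_neg[of A] f1_upper[of A] f2_bound[of A] F_pos[of A] by linarith+
  then show "0 < A1" "0 \<le> K"
    using A by (auto simp: zero_less_mult_iff zero_less_divide_iff zero_le_mult_iff zero_le_divide_iff)
qed

lemma F_continuous: "continuous_on {0<..A} F" and f1_continuous: "continuous_on {0<..A} f1"
  by (rule DERIV_continuous_on[OF F_deriv] DERIV_continuous_on[OF f1_deriv]; assumption)+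

lemma F_deriv_at: "0 < x \<Longrightarrow> x < A \<Longrightarrow> DERIV F x :> f1 x"
  using F_deriv[of x] at_within_open_subset[of x "{0<..<A}" "{0<..A}"]
  by (simp add: subset_iff)

text \<open>The bounds on the logarithmic derivative make \<open>F\<close> vary like a power of its argument.\<close>

lemma F_scale_powr:
  assumes "0 < x" "x \<le> y" "y \<le> A"
  shows "F y * y powr A2 \<le> F x * x powr A2"
proof (rule DERIV_nonpos_imp_decreasing_open[OF assms(2)])
  fix z assume z: "x < z" "z < y"
  have "DERIV (\<lambda>z. F z * z powr A2) z :> f1 z * z powr A2 + A2 * z powr (A2 - 1) * F z"
    using z assms by (intro DERIV_mult F_deriv_at has_real_derivative_powr) auto
  moreover have "f1 z * z powr A2 + A2 * z powr (A2 - 1) * F z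
      = (f1 z + A2 * F z / z) * z powr A2"
    using z assms by (simp add: powr_diff field_simps)
  moreover have "(f1 z + A2 * F z / z) * z powr A2 \<le> 0"
    using f1_lower[of z] z assms by (intro mult_nonpos_nonneg) auto
  ultimately show "\<exists>l. DERIV (\<lambda>z. F z * z powr A2) z :> l \<and> l \<le> 0"
    by metis
next
  show "continuous_on {x..y} (\<lambda>z. F z * z powr A2)"
    using assms by (intro continuous_intros continuous_on_subset[OF F_continuous]) auto
qed

lemma F_antimono:
  assumes "0 < x" "x \<le> y" "y \<le> A"
  shows "F y \<le> F x"
proof -
  have "F y * x powr A2 \<le> F y * y powr A2"
    using assms A2 F_pos[of y] by (intro mult_left_mono powr_mono2) auto
  also have "\<dots> \<le> F x * x powr A2"
    by (rule F_scale_powr[OF assms])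
  finally show ?thesis
    using assms by simp
qed

lemma F_scale:
  assumes "0 < x" "x \<le> A" "0 < \<theta>" "\<theta> \<le> 1"
  shows "F x \<le> F (\<theta> * x) * \<theta> powr A2"
proof -
  have "\<theta> * x \<le> 1 * x"
    using assms by (intro mult_right_mono) auto
  then have "F x * x powr A2 \<le> F (\<theta> * x) * (\<theta> * x) powr A2"
    using assms by (intro F_scale_powr) auto
  then show ?thesis
    using assms by (simp add: powr_mult flip: mult.assoc)
qed

lemma F_scale_upper:
  assumes "0 < x" "x \<le> A" "0 < \<theta>" "\<theta> \<le> 1"
  shows "F (\<theta> * x) * \<theta> powr A1 \<le> F x"
proof -
  have le: "\<theta> * x \<le> x"
    using mult_right_mono[OF assms(4), of x] assms by simp
  have pos: "0 < \<theta> * x"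
    using assms by simp
  have "F (\<theta> * x) * (\<theta> * x) powr A1 \<le> F x * x powr A1"
  proof (rule DERIV_nonneg_imp_increasing_open[OF le])
    fix z assume z: "\<theta> * x < z" "z < x"
    then have z0: "0 < z" "z < A" using pos assms by linarith+
    have "DERIV (\<lambda>z. F z * z powr A1) z :> f1 z * z powr A1 + A1 * z powr (A1 - 1) * F z"
      using z0 by (intro DERIV_mult F_deriv_at has_real_derivative_powr) auto
    moreover have "f1 z * z powr A1 + A1 * z powr (A1 - 1) * F z = (f1 z + A1 * F z / z) * z powr A1"
      using z0 by (simp add: powr_diff field_simps)
    moreover have "0 \<le> (f1 z + A1 * F z / z) * z powr A1"
      using f1_upper[of z] z0 by (intro mult_nonneg_nonneg) auto
    ultimately show "\<exists>l. DERIV (\<lambda>z. F z * z powr A1) z :> l \<and> 0 \<le> l"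
      by metis
  next
    have "{\<theta> * x..x} \<subseteq> {0<..A}"
    proof
      fix z assume "z \<in> {\<theta> * x..x}"
      then show "z \<in> {0<..A}" using pos assms(2) by simp
    qed
    then show "continuous_on {\<theta> * x..x} (\<lambda>z. F z * z powr A1)"
      using pos by (intro continuous_intros continuous_on_subset[OF F_continuous]) auto
  qed
  then show ?thesis
    using assms by (simp add: powr_mult flip: mult.assoc)
qed

text \<open>
  Inside \<open>[-\<xi>, \<xi>]\<close> the singularity is replaced by the even parabola whose value and slope match
  those of \<open>F\<close> at \<open>\<xi>\<close>. It lies above the value at \<open>\<xi>\<close>, since \<open>F\<close> decreases, and the
  result has a Lipschitz continuous derivative. The function is built from its derivative, which has
  a closed form without case distinctions and is defined on the whole line.
\<close>

lemma flattened_profile: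
  assumes \<xi>: "0 < \<xi>" "\<xi> \<le> A"
  obtains \<Phi> \<phi> where
    "\<And>y. DERIV \<Phi> y :> \<phi> y"
    "\<And>y. \<xi> \<le> \<bar>y\<bar> \<Longrightarrow> \<bar>y\<bar> \<le> A \<Longrightarrow> \<Phi> y = F \<bar>y\<bar>"
    "\<And>y. \<bar>y\<bar> \<le> \<xi> \<Longrightarrow> F \<xi> \<le> \<Phi> y"
    "\<And>y. \<bar>y\<bar> \<le> A \<Longrightarrow> \<bar>\<Phi> y\<bar> \<le> (1 + A1) * F \<xi>"
    "\<And>y. \<bar>\<phi> y\<bar> \<le> A1 * F \<xi> / \<xi>"
    "\<And>y z. \<bar>\<phi> y - \<phi> z\<bar> \<le> (K + A1) * F \<xi> / \<xi>\<^sup>2 * \<bar>y - z\<bar>"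
proof -
  define c where "c = (\<lambda>y. min A (max \<xi> \<bar>y\<bar>))"
  define e where "e = (\<lambda>y. max (- 1) (min 1 (y / \<xi>)))"
  define \<phi> where "\<phi> = (\<lambda>y. f1 (c y) * e y)"
  have F\<xi>: "0 < F \<xi>" using F_pos \<xi> by simp
  have c: "\<xi> \<le> c y" "c y \<le> A" "c y \<in> {0<..A}" for y
    using \<xi> by (auto simp: c_def)
  have c_lip: "\<bar>c y - c z\<bar> \<le> \<bar>y - z\<bar>" for y z
    unfolding c_def by linarith
  have e: "\<bar>e y\<bar> \<le> 1" for y
    unfolding e_def by linarith
  have e_lip: "\<bar>e y - e z\<bar> \<le> 1 / \<xi> * \<bar>y - z\<bar>" for y z
  proof -
    have "\<bar>e y - e z\<bar> \<le> \<bar>y / \<xi> - z / \<xi>\<bar>"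
      unfolding e_def by linarith
    also have "\<dots> = 1 / \<xi> * \<bar>y - z\<bar>"
      using \<xi> by (simp add: abs_divide flip: diff_divide_distrib)
    finally show ?thesis .
  qed
  have f1: "\<bar>f1 x\<bar> \<le> A1 * F \<xi> / \<xi>" if "\<xi> \<le> x" "x \<le> A" for x
  proof -
    have "\<bar>f1 x\<bar> \<le> A1 * F x / x"
      using f1_neg[of x] f1_upper[of x] that \<xi> by auto
    also have "\<dots> \<le> A1 * F \<xi> / \<xi>"
      using that \<xi> A1_pos F_pos[of x] F_antimono[of \<xi> x] by (intro frac_le mult_left_mono) auto
    finally show ?thesis .
  qed
  have f1_lip: "\<bar>f1 x - f1 x'\<bar> \<le> K * F \<xi> / \<xi>\<^sup>2 * \<bar>x - x'\<bar>"
    if "x \<in> {\<xi>..A}" "x' \<in> {\<xi>..A}" for x x'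
  proof (rule field_differentiable_bound[of "{\<xi>..A}" f1 f2, simplified real_norm_def])
    fix z assume z: "z \<in> {\<xi>..A}"
    show "(f1 has_real_derivative f2 z) (at z within {\<xi>..A})"
      using f1_deriv[of z] z \<xi> by (auto intro: has_field_derivative_subset)
    have "\<bar>f2 z\<bar> \<le> K * F z / z\<^sup>2"
      using f2_bound[of z] z \<xi> by auto
    also have "\<dots> \<le> K * F \<xi> / \<xi>\<^sup>2"
      using z \<xi> K_nonneg F_pos[of z] F_antimono[of \<xi> z]
      by (intro frac_le mult_left_mono power_mono) auto
    finally show "\<bar>f2 z\<bar> \<le> K * F \<xi> / \<xi>\<^sup>2" .
  qed (use that in auto)
  have \<phi>_bound: "\<bar>\<phi> y\<bar> \<le> A1 * F \<xi> / \<xi>" for y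
    using mult_mono[OF f1[OF c(1,2)] e[of y], of y] F\<xi> \<xi> A1_pos by (simp add: \<phi>_def abs_mult)
  have \<phi>_lip: "\<bar>\<phi> y - \<phi> z\<bar> \<le> (K + A1) * F \<xi> / \<xi>\<^sup>2 * \<bar>y - z\<bar>" for y z
  proof -
    have "\<phi> y - \<phi> z = (f1 (c y) - f1 (c z)) * e y + f1 (c z) * (e y - e z)"
      by (simp add: \<phi>_def algebra_simps)
    then have "\<bar>\<phi> y - \<phi> z\<bar> \<le> \<bar>f1 (c y) - f1 (c z)\<bar> * \<bar>e y\<bar> + \<bar>f1 (c z)\<bar> * \<bar>e y - e z\<bar>"
      using abs_triangle_ineq[of "(f1 (c y) - f1 (c z)) * e y" "f1 (c z) * (e y - e z)"]
      by (simp add: abs_mult)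
    also have "\<dots> \<le> (K * F \<xi> / \<xi>\<^sup>2 * \<bar>y - z\<bar>) * 1 + (A1 * F \<xi> / \<xi>) * (1 / \<xi> * \<bar>y - z\<bar>)"
    proof (intro add_mono mult_mono)
      show "\<bar>f1 (c y) - f1 (c z)\<bar> \<le> K * F \<xi> / \<xi>\<^sup>2 * \<bar>y - z\<bar>"
        using f1_lip[of "c y" "c z"] c mult_left_mono[OF c_lip[of y z], of "K * F \<xi> / \<xi>\<^sup>2"]
          K_nonneg F\<xi> by fastforce
    qed (use e e_lip f1 c F\<xi> \<xi> A1_pos K_nonneg in auto)
    also have "\<dots> = (K + A1) * F \<xi> / \<xi>\<^sup>2 * \<bar>y - z\<bar>"
      using \<xi> by (simp add: field_simps power2_eq_square)
    finally show ?thesis .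
  qed
  have "((K + A1) * F \<xi> / \<xi>\<^sup>2)-lipschitz_on UNIV \<phi>"
    using \<phi>_lip K_nonneg A1_pos F\<xi> by (auto simp: lipschitz_on_def dist_real_def)
  then obtain G where G: "\<And>y. DERIV G y :> \<phi> y"
    using continuous_antiderivative lipschitz_on_continuous_on by metis
  define \<Phi> where "\<Phi> = (\<lambda>y. G y - G \<xi> + F \<xi>)"
  have \<Phi>: "DERIV \<Phi> y :> \<phi> y" for y
    unfolding \<Phi>_def by (auto intro!: derivative_eq_intros G)
  have "\<phi> (- y) = - \<phi> y" for y
    unfolding \<phi>_def c_def e_def by (auto simp: max_def min_def)
  then have "DERIV (\<lambda>y. \<Phi> y - \<Phi> (- y)) y :> 0" for y
    by (auto intro!: derivative_eq_intros \<Phi> DERIV_chain'[OF _ \<Phi>])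
  then have "\<Phi> y - \<Phi> (- y) = \<Phi> 0 - \<Phi> (- 0)" for y
    by (intro DERIV_isconst_all) auto
  then have even: "\<Phi> \<bar>y\<bar> = \<Phi> y" for y
    by (auto simp: abs_if)
  have "\<exists>k. \<forall>y\<in>{\<xi>..A}. \<Phi> y - F y = k"
  proof (rule has_field_derivative_zero_constant)
    fix y assume y: "y \<in> {\<xi>..A}"
    then have "c y = y" "e y = 1"
      using \<xi> by (auto simp: c_def e_def)
    then have "\<phi> y = f1 y" by (simp add: \<phi>_def)
    moreover have "(F has_real_derivative f1 y) (at y within {\<xi>..A})"
      using F_deriv[of y] y \<xi> by (auto intro: has_field_derivative_subset)
    ultimately show "((\<lambda>y. \<Phi> y - F y) has_real_derivative 0) (at y within {\<xi>..A})"
      by (auto intro!: derivative_eq_intros has_field_derivative_at_within[OF \<Phi>])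
  qed simp
  then obtain k where k: "\<And>y. y \<in> {\<xi>..A} \<Longrightarrow> \<Phi> y - F y = k"
    by blast
  have "k = 0"
    using k[of \<xi>] \<xi> by (simp add: \<Phi>_def)
  then have outer: "\<Phi> y = F y" if "\<xi> \<le> y" "y \<le> A" for y
    using k[of y] that by simp
  have inner: "\<Phi> \<xi> \<le> \<Phi> y" if "0 \<le> y" "y \<le> \<xi>" for y
  proof (rule DERIV_nonpos_imp_nonincreasing[OF that(2)])
    fix z assume z: "y \<le> z" "z \<le> \<xi>"
    then have "0 \<le> e z"
      using that \<xi> by (auto simp: e_def le_max_iff_disj)
    then have "\<phi> z \<le> 0"
      using f1_neg[OF c(3)[of z]] by (simp add: \<phi>_def mult_nonpos_nonneg)
    then show "\<exists>l. DERIV \<Phi> z :> l \<and> l \<le> 0"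
      using \<Phi> by blast
  qed
  have upper: "\<bar>\<Phi> y\<bar> \<le> (1 + A1) * F \<xi>" if "0 \<le> y" "y \<le> A" for y
  proof (cases "y \<le> \<xi>")
    case True
    have "\<bar>\<Phi> y - \<Phi> \<xi>\<bar> \<le> A1 * F \<xi> / \<xi> * \<bar>y - \<xi>\<bar>"
      using \<Phi> \<phi>_bound
      by (intro field_differentiable_bound[of UNIV \<Phi> \<phi>, simplified real_norm_def]) auto
    also have "\<dots> \<le> A1 * F \<xi> / \<xi> * \<xi>"
      using True that \<xi> A1_pos F\<xi> by (intro mult_left_mono) auto
    also have "\<dots> = A1 * F \<xi>" using \<xi> by simp
    finally have "\<Phi> y \<le> (1 + A1) * F \<xi>"
      by (simp add: \<Phi>_def algebra_simps abs_le_iff)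
    moreover have "0 \<le> \<Phi> y"
      using inner[of y] True that F\<xi> by (simp add: \<Phi>_def)
    ultimately show ?thesis by simp
  next
    case False
    then have "\<bar>\<Phi> y\<bar> \<le> 1 * F \<xi>"
      using outer[of y] F_antimono[of \<xi> y] F_pos[of y] that \<xi> by auto
    also have "\<dots> \<le> (1 + A1) * F \<xi>"
      using A1_pos F\<xi> by (intro mult_right_mono) auto
    finally show ?thesis .
  qed
  show ?thesis
  proof (rule that[of \<Phi> \<phi>])
    show "\<Phi> y = F \<bar>y\<bar>" if "\<xi> \<le> \<bar>y\<bar>" "\<bar>y\<bar> \<le> A" for y
      using outer[of "\<bar>y\<bar>"] that even by simp
    show "F \<xi> \<le> \<Phi> y" if "\<bar>y\<bar> \<le> \<xi>" for y
      using inner[of "\<bar>y\<bar>"] that even by (simp add: \<Phi>_def)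
    show "\<bar>\<Phi> y\<bar> \<le> (1 + A1) * F \<xi>" if "\<bar>y\<bar> \<le> A" for y
      using upper[of "\<bar>y\<bar>"] that even by simp
  qed (use \<Phi> \<phi>_bound \<phi>_lip in auto)
qed

text \<open>
  After flattening at \<open>\<xi>\<close>, the composition with \<open>g\<close> has size of order \<open>F(\<xi>)\<close> and varies on the scale
  \<open>\<xi>\<close>, so that \<open>M\<close> of order \<open>F(\<xi>)\<close> and \<open>m\<close> of order \<open>1 / \<xi>\<close> are admissible in the multiscale
  construction.
\<close>
lemma weight_polynomial:
  fixes g g' :: "real \<Rightarrow> real"
  assumes per: "\<And>t. g (t + 2 * pi) = g t"
    and range: "\<And>t. \<bar>g t\<bar> \<le> A"
    and der: "\<And>t. DERIV g t :> g' t"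
    and g': "\<And>t. \<bar>g' t\<bar> \<le> D" "\<And>s t. \<bar>g' s - g' t\<bar> \<le> D' * \<bar>s - t\<bar>"
  obtains C where "C > 0"
    "\<And>\<xi>. 0 < \<xi> \<Longrightarrow> \<xi> \<le> A \<Longrightarrow> 1 \<le> F \<xi> \<Longrightarrow> \<exists>d h. real d \<le> C * (F \<xi> / \<xi>) \<and>
       exp_approx d 3 (C * (F \<xi> / \<xi>)) h \<and>
       (\<forall>t. \<xi> \<le> \<bar>g t\<bar> \<longrightarrow> h t = - F \<bar>g t\<bar>) \<and> (\<forall>t. \<bar>g t\<bar> \<le> \<xi> \<longrightarrow> h t \<le> - F \<xi>)"
proof -
  have D: "0 \<le> D" "0 \<le> D'"
    using g'(1)[of 0] g'(2)[of 0 1] by auto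
  define K0 where "K0 = 1 + A1 + A1 * D + (K + A1) * D\<^sup>2 + A1 * D' * A"
  have pos: "0 \<le> A1 * D" "0 \<le> (K + A1) * D\<^sup>2" "0 \<le> A1 * D' * A"
    using D A1_pos K_nonneg A by auto
  have K0: "1 \<le> K0" "1 + A1 \<le> K0" "A1 * D \<le> K0" "(K + A1) * D\<^sup>2 + A1 * D' * A \<le> K0"
    using pos A1_pos by (auto simp: K0_def)
  have "\<exists>d h. real d \<le> 67200 * (K0 * (1 + A)) * (F \<xi> / \<xi>) \<and>
       exp_approx d 3 (67200 * (K0 * (1 + A)) * (F \<xi> / \<xi>)) h \<and>
       (\<forall>t. \<xi> \<le> \<bar>g t\<bar> \<longrightarrow> h t = - F \<bar>g t\<bar>) \<and> (\<forall>t. \<bar>g t\<bar> \<le> \<xi> \<longrightarrow> h t \<le> - F \<xi>)"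
    if \<xi>: "0 < \<xi>" "\<xi> \<le> A" "1 \<le> F \<xi>" for \<xi>
  proof -
    obtain \<Phi> \<phi> where \<Phi>: "\<And>y. DERIV \<Phi> y :> \<phi> y"
      "\<And>y. \<xi> \<le> \<bar>y\<bar> \<Longrightarrow> \<bar>y\<bar> \<le> A \<Longrightarrow> \<Phi> y = F \<bar>y\<bar>"
      "\<And>y. \<bar>y\<bar> \<le> \<xi> \<Longrightarrow> F \<xi> \<le> \<Phi> y"
      "\<And>y. \<bar>y\<bar> \<le> A \<Longrightarrow> \<bar>\<Phi> y\<bar> \<le> (1 + A1) * F \<xi>"
      and \<phi>: "\<And>y. \<bar>\<phi> y\<bar> \<le> A1 * F \<xi> / \<xi>"
      "\<And>y z. \<bar>\<phi> y - \<phi> z\<bar> \<le> (K + A1) * F \<xi> / \<xi>\<^sup>2 * \<bar>y - z\<bar>"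
      using flattened_profile[OF \<xi>(1,2)] by blast
    define m where "m = nat \<lceil>1 / \<xi>\<rceil>"
    have m: "1 / \<xi> \<le> real m" "real m \<le> 1 / \<xi> + 1" "1 \<le> m"
    proof -
      have "0 < 1 / \<xi>" using \<xi> by simp
      then show "1 / \<xi> \<le> real m" "real m \<le> 1 / \<xi> + 1" "1 \<le> m"
        unfolding m_def by linarith+
    qed
    define H where "H = (\<lambda>t. \<Phi> (g t))"
    define H' where "H' = (\<lambda>t. \<phi> (g t) * g' t)"
    have sq: "F \<xi> / \<xi>\<^sup>2 \<le> F \<xi> * (real m)\<^sup>2"
    proof -
      have "(1 / \<xi>)\<^sup>2 \<le> (real m)\<^sup>2"
        using m \<xi> by (intro power_mono) auto
      then have "F \<xi> * (1 / \<xi>)\<^sup>2 \<le> F \<xi> * (real m)\<^sup>2"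
        using \<xi> by (intro mult_left_mono) auto
      then show ?thesis by (simp add: power_divide)
    qed
    obtain d where d: "real d \<le> 67200 * (K0 * F \<xi> * real m)"
      "exp_approx d 3 (1674 * (K0 * F \<xi> * real m)) (\<lambda>t. - H t)"
    proof (rule exp_approx_slowly_varying[of H H' "K0 * F \<xi>" m])
      show "H (t + 2 * pi) = H t" for t
        by (simp add: H_def per)
      show "DERIV H t :> H' t" for t
        unfolding H_def H'_def by (rule DERIV_chain2[OF \<Phi>(1) der])
      show "\<bar>H t\<bar> \<le> K0 * F \<xi>" for t
      proof -
        have "(1 + A1) * F \<xi> \<le> K0 * F \<xi>"
          using K0 \<xi> by (intro mult_right_mono) auto
        then show ?thesis using \<Phi>(4)[OF range[of t]] by (simp add: H_def)
      qed
      show "\<bar>H' t\<bar> \<le> K0 * F \<xi> * real m" for t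
      proof -
        have "\<bar>H' t\<bar> \<le> (A1 * F \<xi> / \<xi>) * D"
          unfolding H'_def abs_mult using \<xi> A1_pos by (intro mult_mono \<phi> g') auto
        also have "\<dots> = (A1 * D) * F \<xi> * (1 / \<xi>)"
          by simp
        also have "\<dots> \<le> K0 * F \<xi> * real m"
          using K0 \<xi> m pos by (intro mult_mono) auto
        finally show ?thesis .
      qed
      show "\<bar>H' s - H' t\<bar> \<le> K0 * F \<xi> * (real m)\<^sup>2 * \<bar>s - t\<bar>" for s t
      proof -
        have glip: "\<bar>g s - g t\<bar> \<le> D * \<bar>s - t\<bar>"
          using der g'(1)
          by (intro field_differentiable_bound[of UNIV g g', simplified real_norm_def]) auto
        have "H' s - H' t = (\<phi> (g s) - \<phi> (g t)) * g' s + \<phi> (g t) * (g' s - g' t)"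
          by (simp add: H'_def algebra_simps)
        then have "\<bar>H' s - H' t\<bar> \<le> \<bar>\<phi> (g s) - \<phi> (g t)\<bar> * \<bar>g' s\<bar> + \<bar>\<phi> (g t)\<bar> * \<bar>g' s - g' t\<bar>"
          using abs_triangle_ineq[of "(\<phi> (g s) - \<phi> (g t)) * g' s" "\<phi> (g t) * (g' s - g' t)"]
          by (simp add: abs_mult)
        also have "\<dots> \<le> ((K + A1) * F \<xi> / \<xi>\<^sup>2 * (D * \<bar>s - t\<bar>)) * D + (A1 * F \<xi> / \<xi>) * (D' * \<bar>s - t\<bar>)"
        proof (intro add_mono mult_mono g' \<phi>)
          have "0 \<le> (K + A1) * F \<xi> / \<xi>\<^sup>2"
            using K_nonneg A1_pos \<xi> by simp
          from mult_left_mono[OF glip this] \<phi>(2)[of "g s" "g t"]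
          show "\<bar>\<phi> (g s) - \<phi> (g t)\<bar> \<le> (K + A1) * F \<xi> / \<xi>\<^sup>2 * (D * \<bar>s - t\<bar>)"
            by linarith
        qed (use K_nonneg A1_pos \<xi> D in auto)
        also have "\<dots> = ((K + A1) * D\<^sup>2 + A1 * D' * \<xi>) * (F \<xi> / \<xi>\<^sup>2) * \<bar>s - t\<bar>"
          using \<xi> by (simp add: field_simps power2_eq_square)
        also have "\<dots> \<le> K0 * (F \<xi> * (real m)\<^sup>2) * \<bar>s - t\<bar>"
        proof (intro mult_right_mono mult_mono sq)
          have "A1 * D' * \<xi> \<le> A1 * D' * A"
            using \<xi> A1_pos D by (intro mult_left_mono) auto
          then show "(K + A1) * D\<^sup>2 + A1 * D' * \<xi> \<le> K0"
            using K0(4) by linarith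
        qed (use K0 \<xi> in auto)
        finally show ?thesis by (simp add: mult.assoc)
      qed
      show "1 \<le> K0 * F \<xi>"
        using mult_mono[OF K0(1) \<xi>(3)] K0 by simp
    qed (use m in auto)
    have "K0 * F \<xi> * real m \<le> K0 * F \<xi> * ((1 + A) / \<xi>)"
    proof (intro mult_left_mono)
      have "1 \<le> A / \<xi>" using \<xi> by simp
      then show "real m \<le> (1 + A) / \<xi>"
        using m(2) by (simp add: add_divide_distrib)
    qed (use K0 \<xi> in auto)
    then have Km: "K0 * F \<xi> * real m \<le> K0 * (1 + A) * (F \<xi> / \<xi>)"
      by (simp add: mult_ac)
    have nn: "0 \<le> K0 * F \<xi> * real m"
      using K0 \<xi> by simp
    have "exp_approx d 3 (67200 * (K0 * (1 + A)) * (F \<xi> / \<xi>)) (\<lambda>t. - H t)"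
      using Km nn by (intro exp_approx_perturb[OF d(2), where e = 0]) auto
    moreover have "real d \<le> 67200 * (K0 * (1 + A)) * (F \<xi> / \<xi>)"
      using d(1) Km by linarith
    moreover have "- H t = - F \<bar>g t\<bar>" if "\<xi> \<le> \<bar>g t\<bar>" for t
      using \<Phi>(2)[OF that range] by (simp add: H_def)
    moreover have "- H t \<le> - F \<xi>" if "\<bar>g t\<bar> \<le> \<xi>" for t
      using \<Phi>(3)[OF that] by (simp add: H_def)
    ultimately show ?thesis
      by blast
  qed
  moreover have "0 < 67200 * (K0 * (1 + A))"
    using K0 A by simp
  ultimately show ?thesis
    using that by blast
qed

end

section \<open>Neighbourhoods of the zeros\<close>

text \<open>
  Near a simple zero \<open>\<bar>g\<bar>\<close> is bounded below by a multiple of the distance to it, and near any other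
  point by a constant; finitely many such neighbourhoods cover a period.
\<close>
lemma simple_zeros_lower_bound:
  fixes g g' :: "real \<Rightarrow> real"
  assumes der: "\<And>t. DERIV g t :> g' t"
    and simple: "\<And>t. g t = 0 \<Longrightarrow> g' t \<noteq> 0"
  obtains Z c where "finite Z" "Z \<subseteq> {0..2 * pi}" "c > 0"
    "\<And>t r. t \<in> {0..2 * pi} \<Longrightarrow> 0 < r \<Longrightarrow> r \<le> 1 \<Longrightarrow> (\<And>z. z \<in> Z \<Longrightarrow> r \<le> \<bar>t - z\<bar>) \<Longrightarrow> c * r \<le> \<bar>g t\<bar>"
proof -
  have "\<exists>e>0. \<exists>c>0. \<forall>t\<in>ball x e. if g x = 0 then c * \<bar>t - x\<bar> \<le> \<bar>g t\<bar> else c \<le> \<bar>g t\<bar>" for x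
  proof (cases "g x = 0")
    case True
    then have pos: "\<bar>g' x\<bar> / 2 > 0"
      using simple by simp
    have "(g has_derivative (\<lambda>h. g' x * h)) (at x)"
      using der[of x] unfolding has_field_derivative_def .
    then obtain e where e: "e > 0"
      "\<And>t. norm (t - x) < e \<Longrightarrow> norm (g t - g x - g' x * (t - x)) \<le> \<bar>g' x\<bar> / 2 * norm (t - x)"
      using pos unfolding has_derivative_at_alt by blast
    have "\<bar>g' x\<bar> / 2 * \<bar>t - x\<bar> \<le> \<bar>g t\<bar>" if "t \<in> ball x e" for t
    proof -
      have "\<bar>g t - g' x * (t - x)\<bar> \<le> \<bar>g' x\<bar> / 2 * \<bar>t - x\<bar>"
        using e(2)[of t] that True by (simp add: dist_real_def abs_minus_commute)
      moreover have "\<bar>g' x * (t - x)\<bar> = \<bar>g' x\<bar> * \<bar>t - x\<bar>"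
        by (simp add: abs_mult)
      ultimately show ?thesis by linarith
    qed
    then show ?thesis
      using e(1) pos True by (intro exI[of _ e] conjI exI[of _ "\<bar>g' x\<bar> / 2"]) auto
  next
    case False
    have "isCont g x"
      using der DERIV_isCont by blast
    then obtain e where e: "e > 0" "\<And>t. dist t x < e \<Longrightarrow> dist (g t) (g x) < \<bar>g x\<bar> / 2"
      using False unfolding continuous_at_eps_delta by (meson half_gt_zero zero_less_abs_iff)
    have "\<bar>g x\<bar> / 2 \<le> \<bar>g t\<bar>" if "t \<in> ball x e" for t
    proof -
      have "\<bar>g t - g x\<bar> < \<bar>g x\<bar> / 2"
        using e(2)[of t] that by (simp add: dist_real_def abs_minus_commute)
      then show ?thesis by linarith
    qed
    then show ?thesis
      using e(1) False by (intro exI[of _ e] conjI exI[of _ "\<bar>g x\<bar> / 2"]) auto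
  qed
  then obtain e c where e: "\<And>x. e x > 0" and c: "\<And>x. c x > 0"
    and low: "\<And>x t. t \<in> ball x (e x) \<Longrightarrow> if g x = 0 then c x * \<bar>t - x\<bar> \<le> \<bar>g t\<bar> else c x \<le> \<bar>g t\<bar>"
    by metis
  obtain X where X: "X \<subseteq> {0..2 * pi}" "finite X" "{0..2 * pi} \<subseteq> (\<Union>x\<in>X. ball x (e x))"
  proof (rule compactE_image[of "{0..2 * pi}" "{0..2 * pi}" "\<lambda>x. ball x (e x)"])
    show "{0..2 * pi} \<subseteq> (\<Union>x\<in>{0..2 * pi}. ball x (e x))"
      using e by force
  qed (auto intro: that)
  have "X \<noteq> {}"
    using X(3) by auto
  define c0 where "c0 = Min (c ` X)"
  have c0: "c0 > 0" "\<And>x. x \<in> X \<Longrightarrow> c0 \<le> c x"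
    using X \<open>X \<noteq> {}\<close> c by (auto simp: c0_def)
  show ?thesis
  proof (rule that[of "{x \<in> X. g x = 0}" c0])
    fix t r :: real
    assume t: "t \<in> {0..2 * pi}" and r: "0 < r" "r \<le> 1"
      and far: "\<And>z. z \<in> {x \<in> X. g x = 0} \<Longrightarrow> r \<le> \<bar>t - z\<bar>"
    obtain x where x: "x \<in> X" "t \<in> ball x (e x)"
      using X(3) t by blast
    have "c0 * r \<le> c x * s" if "r \<le> s" for s
      using c0 x(1) r that by (intro mult_mono) (auto intro: less_imp_le c)
    from this[of 1] this[of "\<bar>t - x\<bar>"]
    have "c0 * r \<le> (if g x = 0 then c x * \<bar>t - x\<bar> else c x)"
      using x(1) far r by auto
    then show "c0 * r \<le> \<bar>g t\<bar>"
      using low[OF x(2)] by (auto split: if_splits)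
  qed (use X c0 in auto)
qed

text \<open>
  A neighbourhood of a point of \<open>[0, 2 pi]\<close> of radius at most one meets the fundamental domain in at
  most three of its translates, whence the factor six.
\<close>
lemma remez_set:
  fixes Z :: "real set" and r :: real
  defines "E \<equiv> circle_proj (\<Union>z\<in>Z. {z - r..z + r})"
  assumes Z: "finite Z" "Z \<subseteq> {0..2 * pi}" and r: "0 < r" "r \<le> 1"
  shows "l \<le> 2 * r \<Longrightarrow> interval_union l E"
    and "E \<in> sets lebesgue"
    and "measure lebesgue E \<le> 6 * r * real (card Z)"
    and "t \<in> circle - E \<Longrightarrow> z \<in> Z \<Longrightarrow> r \<le> \<bar>t - z\<bar>"
proof -
  define S where "S = (\<lambda>z k. {z - r - 2 * pi * real_of_int k..z + r - 2 * pi * real_of_int k})"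
  have E: "E = circle \<inter> (\<Union>z\<in>Z. \<Union>k\<in>{-1,0,1}. S z k)"
  proof (intro equalityI subsetI)
    fix t assume "t \<in> E"
    then obtain z k where t: "t \<in> circle" and z: "z \<in> Z"
      and k: "z - r \<le> t + 2 * pi * of_int k" "t + 2 * pi * of_int k \<le> z + r"
      unfolding E_def circle_proj_def by auto
    have tz: "0 \<le> t" "t < 2 * pi" "0 \<le> z" "z \<le> 2 * pi"
      using t z Z(2) by (auto simp: circle_def)
    have p: "2 * pi > 1" using pi_gt3 by linarith
    have "pi * of_int k < pi * 2" "pi * (- 2) < pi * of_int k"
      using k tz r p by linarith+
    then have "of_int k < (2::real)" "(-2::real) < of_int k"
      by (simp_all only: mult_less_cancel_left_pos[OF pi_gt_zero])
    then have "k \<in> {-1,0,1}" by auto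
    moreover have "t \<in> S z k"
      using k by (simp add: S_def)
    ultimately show "t \<in> circle \<inter> (\<Union>z\<in>Z. \<Union>k\<in>{-1,0,1}. S z k)"
      using t z by blast
  next
    fix t assume "t \<in> circle \<inter> (\<Union>z\<in>Z. \<Union>k\<in>{-1,0,1}. S z k)"
    then obtain z k where "t \<in> circle" "z \<in> Z" "t \<in> S z k" by blast
    then show "t \<in> E"
      unfolding E_def circle_proj_def S_def
      by (auto intro!: exI[of _ k] bexI[of _ z])
  qed
  have S: "S z k \<in> lmeasurable" "measure lebesgue (S z k) = 2 * r" for z k
    using r by (auto simp: S_def)
  show sets: "E \<in> sets lebesgue"
    unfolding E circle_def S_def using Z(1) by (intro sets.Int sets.finite_UN) auto
  have U: "(\<Union>k\<in>{-1,0,1}. S z k) \<in> lmeasurable" for z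
    using S by auto
  have "measure lebesgue E \<le> measure lebesgue (\<Union>z\<in>Z. \<Union>k\<in>{-1,0,1}. S z k)"
  proof (rule measure_mono_fmeasurable)
    show "E \<subseteq> (\<Union>z\<in>Z. \<Union>k\<in>{-1,0,1}. S z k)"
      using E by blast
    show "(\<Union>z\<in>Z. \<Union>k\<in>{-1,0,1}. S z k) \<in> lmeasurable"
      using Z(1) U by (rule fmeasurable.finite_UN)
  qed (rule sets)
  also have "\<dots> \<le> (\<Sum>z\<in>Z. measure lebesgue (\<Union>k\<in>{-1,0,1}. S z k))"
    using U Z(1) by (intro measure_UNION_le) (auto simp: fmeasurableD)
  also have "\<dots> \<le> (\<Sum>z\<in>Z. \<Sum>k\<in>{-1,0,1::int}. measure lebesgue (S z k))"
    using S by (intro sum_mono measure_UNION_le) (auto simp: fmeasurableD)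
  also have "\<dots> = 6 * r * real (card Z)"
    by (simp add: S)
  finally show "measure lebesgue E \<le> 6 * r * real (card Z)" .
  show "interval_union l E" if "l \<le> 2 * r"
    unfolding interval_union_def E_def
  proof (intro exI[of _ "(\<lambda>z. {z - r..z + r}) ` Z"] conjI ballI)
    fix I assume "I \<in> (\<lambda>z. {z - r..z + r}) ` Z"
    then obtain z where "I = {z - r..z + r}" by blast
    then show "\<exists>a b. l \<le> b - a \<and> {a<..<b} \<subseteq> I \<and> I \<subseteq> {a..b}"
      using that by (intro exI[of _ "z - r"] exI[of _ "z + r"]) auto
  qed (use Z(1) in auto)
  show "r \<le> \<bar>t - z\<bar>" if "t \<in> circle - E" "z \<in> Z"
  proof (rule ccontr)
    assume "\<not> r \<le> \<bar>t - z\<bar>"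
    then have "t \<in> S z 0" by (auto simp: S_def)
    then show False using that E by auto
  qed
qed

section \<open>The weighted quasi-norms\<close>

lemma ennreal_powr_le:
  assumes P: "0 < P" and c: "0 < c" and le: "x \<le> ennreal (c powr P) * y"
  shows "ennreal_powr x (1 / P) \<le> ennreal c * ennreal_powr y (1 / P)"
proof (cases "y = \<infinity>")
  case True
  then show ?thesis
    using c by (simp add: ennreal_powr_def ennreal_mult_top)
next
  case False
  then obtain b where b: "y = ennreal b" "0 \<le> b"
    by (cases y) auto
  then have x: "x \<le> ennreal (c powr P * b)"
    using le by (simp add: ennreal_mult)
  then obtain a where a: "x = ennreal a" "0 \<le> a"
    using le_ennreal_iff b by (cases x) (auto simp: top_unique)
  have "a powr (1 / P) \<le> (c powr P * b) powr (1 / P)"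
    using x a b P by (intro powr_mono2) auto
  also have "\<dots> = c * b powr (1 / P)"
    using b c P by (simp add: powr_mult powr_powr)
  finally show ?thesis
    using a b c by (simp add: ennreal_powr_def ennreal_mult[symmetric] ennreal_leI)
qed

lemma Lp_norm_restrict_space:
  assumes "p \<noteq> \<infinity>" "E \<in> sets lebesgue"
  shows "Lp_norm p w E f = ennreal_powr
    (\<integral>\<^sup>+t. ennreal (cmod (f t) powr enn2real p * w t) \<partial>restrict_space lebesgue E) (1 / enn2real p)"
  using assms by (simp add: Lp_norm_def nn_integral_restrict_space)

lemma borel_measurable_restrict_lebesgue:
  assumes "f \<in> borel_measurable borel"
  shows "f \<in> borel_measurable (restrict_space lebesgue E)"
  using assms by (intro measurable_restrict_space1 measurable_completion) simp

lemma enn2real_pos: "0 < p \<Longrightarrow> p \<noteq> \<infinity> \<Longrightarrow> 0 < enn2real p"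
  by (cases p) (auto simp: enn2real_positive_iff top.not_eq_extremum)

context
  fixes p :: ennreal and u :: "real \<Rightarrow> real" and E :: "real set"
  assumes p: "0 < p" and u_nonneg: "\<And>t. 0 \<le> u t"
    and E: "E \<in> sets lebesgue" and u: "u \<in> borel_measurable (restrict_space lebesgue E)"
begin

lemma Lp_norm_mono:
  assumes E': "E' \<in> sets lebesgue" "E' \<subseteq> E"
    and f: "f \<in> borel_measurable borel" and h: "h \<in> borel_measurable borel"
    and c: "0 < c" and le: "\<And>t. t \<in> E' \<Longrightarrow> cmod (f t) \<le> c * cmod (h t)"
  shows "Lp_norm p u E' f \<le> ennreal c * Lp_norm p u E h"
proof -
  note [measurable] = u borel_measurable_restrict_lebesgue[OF f] borel_measurable_restrict_lebesgue[OF h]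
  have u' [measurable]: "u \<in> borel_measurable (restrict_space lebesgue E')"
  proof -
    have "restrict_space (restrict_space lebesgue E) E' = restrict_space lebesgue E'"
      using restrict_restrict_space[of E lebesgue E'] E E'(1) Int_absorb1[OF E'(2)] by simp
    then show ?thesis
      using measurable_restrict_space1[OF u, of E'] by simp
  qed
  show ?thesis
  proof (cases "p = \<infinity>")
    case True
    let ?S = "esssup (restrict_space lebesgue E) (\<lambda>t. ennreal (cmod (h t * of_real (u t))))"
    have "AE t in lebesgue. t \<in> E \<longrightarrow> ennreal (cmod (h t * of_real (u t))) \<le> ?S"
      using esssup_AE[of "\<lambda>t. ennreal (cmod (h t * of_real (u t)))" "restrict_space lebesgue E"] E
      by (simp add: AE_restrict_space_iff)
    then have "AE t in lebesgue. t \<in> E' \<longrightarrow> ennreal (cmod (f t * of_real (u t))) \<le> ennreal c * ?S"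
    proof eventually_elim
      case (elim t)
      show ?case
      proof
        assume t: "t \<in> E'"
        have "cmod (f t * of_real (u t)) \<le> c * cmod (h t * of_real (u t))"
          using mult_right_mono[OF le[OF t] u_nonneg[of t]] u_nonneg[of t] by (simp add: norm_mult)
        then have "ennreal (cmod (f t * of_real (u t))) \<le> ennreal c * ennreal (cmod (h t * of_real (u t)))"
          using c by (simp add: ennreal_leI flip: ennreal_mult)
        also have "\<dots> \<le> ennreal c * ?S"
          using elim t E' by (intro mult_left_mono) auto
        finally show "ennreal (cmod (f t * of_real (u t))) \<le> ennreal c * ?S" .
      qed
    qed
    then have "AE t in restrict_space lebesgue E'. ennreal (cmod (f t * of_real (u t))) \<le> ennreal c * ?S"
      using E' by (simp add: AE_restrict_space_iff)
    moreover have "(\<lambda>t. ennreal (cmod (f t * of_real (u t)))) \<in> borel_measurable (restrict_space lebesgue E')"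
      by measurable
    ultimately show ?thesis
      using True by (simp add: Lp_norm_def esssup_I)
  next
    case False
    let ?P = "enn2real p"
    have P: "0 < ?P"
      by (rule enn2real_pos[OF p False])
    have "(\<integral>\<^sup>+t\<in>E'. ennreal (cmod (f t) powr ?P * u t) \<partial>lebesgue)
        \<le> (\<integral>\<^sup>+t\<in>E. ennreal (c powr ?P) * ennreal (cmod (h t) powr ?P * u t) \<partial>lebesgue)"
    proof (intro nn_integral_mono)
      fix t
      have "cmod (f t) powr ?P * u t \<le> c powr ?P * (cmod (h t) powr ?P * u t)" if "t \<in> E'"
      proof -
        have "cmod (f t) powr ?P \<le> (c * cmod (h t)) powr ?P"
          using le[OF that] P by (intro powr_mono2) auto
        from mult_right_mono[OF this u_nonneg[of t]] show ?thesis
          using c by (simp add: powr_mult mult.assoc)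
      qed
      then have "t \<in> E' \<Longrightarrow> ennreal (cmod (f t) powr ?P * u t)
          \<le> ennreal (c powr ?P) * ennreal (cmod (h t) powr ?P * u t)"
        using u_nonneg[of t] by (simp add: ennreal_leI flip: ennreal_mult)
      then show "ennreal (cmod (f t) powr ?P * u t) * indicator E' t
          \<le> ennreal (c powr ?P) * ennreal (cmod (h t) powr ?P * u t) * indicator E t"
        using E' by (auto simp: indicator_def)
    qed
    also have "\<dots> = (\<integral>\<^sup>+t. ennreal (c powr ?P) * ennreal (cmod (h t) powr ?P * u t) \<partial>restrict_space lebesgue E)"
      using E by (simp add: nn_integral_restrict_space)
    also have "\<dots> = ennreal (c powr ?P) * (\<integral>\<^sup>+t. ennreal (cmod (h t) powr ?P * u t) \<partial>restrict_space lebesgue E)"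
      by (rule nn_integral_cmult) measurable
    finally show ?thesis
      unfolding Lp_norm_restrict_space[OF False E] using False P c
      by (simp add: Lp_norm_def ennreal_powr_le)
  qed
qed

text \<open>
  One factor two comes from bounding a sum by twice the maximum inside the integral, and
  \<open>2\<^sup>1\<^sup>/\<^sup>p\<close> from doing the same outside. For infinite \<open>p\<close> the exponent \<open>1 / enn2real p\<close> is zero
  by the conventions for \<open>enn2real\<close> and division, and the bound remains valid.
\<close>
lemma Lp_norm_quasi_triangle:
  assumes f: "f \<in> borel_measurable borel" and h: "h \<in> borel_measurable borel"
  shows "Lp_norm p u E (\<lambda>t. f t + h t)
    \<le> ennreal (2 * 2 powr (1 / enn2real p)) * (Lp_norm p u E f + Lp_norm p u E h)"
proof -
  note [measurable] = u borel_measurable_restrict_lebesgue[OF f] borel_measurable_restrict_lebesgue[OF h]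
  let ?M = "restrict_space lebesgue E"
  show ?thesis
  proof (cases "p = \<infinity>")
    case True
    let ?f = "\<lambda>t. ennreal (cmod (f t * of_real (u t)))" and ?h = "\<lambda>t. ennreal (cmod (h t * of_real (u t)))"
    have "AE t in ?M. ennreal (cmod ((f t + h t) * of_real (u t))) \<le> esssup ?M ?f + esssup ?M ?h"
      using esssup_AE[of ?f ?M] esssup_AE[of ?h ?M]
    proof eventually_elim
      case (elim t)
      have "ennreal (cmod ((f t + h t) * of_real (u t)))
          \<le> ennreal (cmod (f t * of_real (u t)) + cmod (h t * of_real (u t)))"
        unfolding distrib_right by (intro ennreal_leI norm_triangle_ineq)
      also have "\<dots> = ?f t + ?h t"
        by (rule ennreal_plus) auto
      finally have "ennreal (cmod ((f t + h t) * of_real (u t))) \<le> ?f t + ?h t" .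
      then show ?case
        using add_mono[OF elim] by (rule order_trans)
    qed
    moreover have "(\<lambda>t. ennreal (cmod ((f t + h t) * of_real (u t)))) \<in> borel_measurable ?M"
      by measurable
    ultimately have "Lp_norm p u E (\<lambda>t. f t + h t) \<le> 1 * (Lp_norm p u E f + Lp_norm p u E h)"
      using True by (simp add: Lp_norm_def esssup_I)
    also have "\<dots> \<le> ennreal (2 * 2 powr (1 / enn2real p)) * (Lp_norm p u E f + Lp_norm p u E h)"
    proof (intro mult_right_mono)
      have "1 \<le> 2 * 2 powr (1 / enn2real p)"
        using True by simp
      then show "1 \<le> ennreal (2 * 2 powr (1 / enn2real p))"
        using ennreal_leI by fastforce
    qed auto
    finally show ?thesis .
  next
    case False
    let ?P = "enn2real p"
    have P: "0 < ?P"
      by (rule enn2real_pos[OF p False])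
    let ?f = "\<lambda>t. ennreal (cmod (f t) powr ?P * u t)" and ?h = "\<lambda>t. ennreal (cmod (h t) powr ?P * u t)"
    let ?X = "\<integral>\<^sup>+t. ?f t \<partial>?M" and ?Y = "\<integral>\<^sup>+t. ?h t \<partial>?M"
    have "(\<integral>\<^sup>+t. ennreal (cmod (f t + h t) powr ?P * u t) \<partial>?M)
        \<le> (\<integral>\<^sup>+t. ennreal (2 powr ?P) * (?f t + ?h t) \<partial>?M)"
    proof (intro nn_integral_mono)
      fix t
      let ?m = "max (cmod (f t)) (cmod (h t))"
      have "cmod (f t + h t) \<le> 2 * ?m"
        using norm_triangle_ineq[of "f t" "h t"] by linarith
      then have "cmod (f t + h t) powr ?P \<le> (2 * ?m) powr ?P"
        using P by (intro powr_mono2) auto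
      also have "\<dots> = 2 powr ?P * ?m powr ?P"
        by (simp add: powr_mult)
      also have "\<dots> \<le> 2 powr ?P * (cmod (f t) powr ?P + cmod (h t) powr ?P)"
        by (intro mult_left_mono) (auto simp: max_def)
      finally have "cmod (f t + h t) powr ?P * u t
          \<le> 2 powr ?P * (cmod (f t) powr ?P + cmod (h t) powr ?P) * u t"
        by (intro mult_right_mono u_nonneg)
      then show "ennreal (cmod (f t + h t) powr ?P * u t) \<le> ennreal (2 powr ?P) * (?f t + ?h t)"
        using u_nonneg[of t]
        by (simp add: ennreal_leI algebra_simps flip: ennreal_mult ennreal_plus)
    qed
    also have "\<dots> = ennreal (2 powr ?P) * (?X + ?Y)"
      by (simp add: nn_integral_cmult nn_integral_add)
    also have "\<dots> \<le> ennreal (2 powr ?P) * (2 * max ?X ?Y)"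
      by (intro mult_left_mono) (auto simp: mult_2 intro: add_mono)
    also have "\<dots> = ennreal ((2 * 2 powr (1 / ?P)) powr ?P) * max ?X ?Y"
      using P by (simp add: powr_mult powr_powr ennreal_mult mult.assoc)
    finally have "ennreal_powr (\<integral>\<^sup>+t. ennreal (cmod (f t + h t) powr ?P * u t) \<partial>?M) (1 / ?P)
        \<le> ennreal (2 * 2 powr (1 / ?P)) * ennreal_powr (max ?X ?Y) (1 / ?P)"
      by (intro ennreal_powr_le P) auto
    also have "\<dots> \<le> ennreal (2 * 2 powr (1 / ?P)) * (ennreal_powr ?X (1 / ?P) + ennreal_powr ?Y (1 / ?P))"
      by (intro mult_left_mono) (auto simp: max_def)
    finally show ?thesis
      unfolding Lp_norm_restrict_space[OF False E] .
  qed
qed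

end

text \<open>
  A factor of the weight can be moved into the function, provided that its \<open>p\<close>-th root is taken for
  finite \<open>p\<close>.
\<close>
lemma Lp_norm_weight_product:
  assumes V: "\<And>t. 0 \<le> V t"
    and \<omega>: "\<And>t. \<omega> t = (if p = \<infinity> then V t else V t powr enn2real p)"
  shows "Lp_norm p (\<lambda>t. \<omega> t * u t) E f = Lp_norm p u E (\<lambda>t. of_real (V t) * f t)"
proof (cases "p = \<infinity>")
  case True
  then show ?thesis
    by (simp add: Lp_norm_def \<omega> mult_ac)
next
  case False
  have "cmod (of_real (V t) * f t) powr enn2real p * u t = cmod (f t) powr enn2real p * (\<omega> t * u t)" for t
    using V[of t] False by (simp add: norm_mult powr_mult \<omega> mult_ac)
  then show ?thesis
    using False by (simp only: Lp_norm_def if_False)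
qed

lemma weight_borel_measurable:
  assumes "weight u"
  shows "u \<in> borel_measurable (restrict_space lebesgue circle)"
proof -
  have "(\<lambda>t. indicator circle t *\<^sub>R u t) \<in> borel_measurable lebesgue"
    using assms unfolding weight_def set_integrable_def by (auto dest: borel_measurable_integrable)
  moreover have "circle \<in> sets lebesgue"
    by (simp add: circle_def)
  ultimately show ?thesis
    by (simp add: borel_measurable_restrict_space_iff)
qed

section \<open>The weighted Bernstein inequality\<close>

lemma ennreal_chain:
  assumes "X \<le> ennreal a * Y" "Y \<le> ennreal b * W" "0 \<le> a" "0 \<le> b"
  shows "X \<le> ennreal (a * b) * W"
proof -
  have "X \<le> ennreal a * (ennreal b * W)"
    using assms(1) mult_left_mono[OF assms(2), of "ennreal a"] by (meson order_trans zero_le)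
  then show ?thesis
    using assms(3,4) by (simp add: ennreal_mult mult.assoc)
qed

lemma ennreal_chain_add:
  assumes "X \<le> ennreal k * (Y1 + Y2)" "Y1 \<le> ennreal a * W" "Y2 \<le> ennreal b * W" "0 \<le> k" "0 \<le> a" "0 \<le> b"
  shows "X \<le> ennreal (k * (a + b)) * W"
proof (rule ennreal_chain[OF assms(1)])
  show "Y1 + Y2 \<le> ennreal (a + b) * W"
    using add_mono[OF assms(2,3)] assms(5,6) by (simp add: distrib_right)
qed (use assms in auto)

lemma trig_poly_borel_measurable: "trig_poly n T \<Longrightarrow> T \<in> borel_measurable borel"
  by (intro borel_measurable_continuous_onI trig_poly_continuous)

context singular_profile
begin

text \<open>
  As \<open>s\<close> decreases to zero, \<open>F(s)\<close> tends to infinity while \<open>\<kappa> n s\<close> tends to zero; at \<open>s0\<close> the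
  order is reversed once \<open>n\<close> is large. The solution is the scale below which a polynomial of degree
  \<open>n\<close> cannot resolve the weight.
\<close>

lemma choose_scale:
  assumes \<kappa>: "0 < \<kappa>" and s0: "0 < s0" "s0 \<le> A"
  obtains n0 :: nat where "1 \<le> n0" "\<And>n. n0 \<le> n \<Longrightarrow> \<exists>s. 0 < s \<and> s \<le> s0 \<and> F s = \<kappa> * real n * s"
proof -
  define n0 where "n0 = nat \<lceil>F s0 / (\<kappa> * s0)\<rceil> + 1"
  have "\<exists>s. 0 < s \<and> s \<le> s0 \<and> F s = \<kappa> * real n * s" if n: "n0 \<le> n" for n
  proof -
    have "F s0 / (\<kappa> * s0) \<le> real n"
      using n unfolding n0_def by linarith
    then have hi: "F s0 \<le> \<kappa> * real n * s0"
      using \<kappa> s0 by (simp add: field_simps)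
    have "eventually (\<lambda>x. \<kappa> * real n * s0 < F x) (at_right 0)"
      using F_blowup by (simp add: filterlim_at_top_dense)
    then obtain b where b: "0 < b" "\<And>x. 0 < x \<Longrightarrow> x < b \<Longrightarrow> \<kappa> * real n * s0 < F x"
      by (auto simp: eventually_at_right_field)
    define s1 where "s1 = min (b / 2) s0"
    have s1: "0 < s1" "s1 \<le> s0" "s1 < b"
      using b(1) s0 by (auto simp: s1_def)
    have "\<kappa> * real n * s1 \<le> \<kappa> * real n * s0"
      using \<kappa> s1 by (intro mult_left_mono) auto
    then have lo: "\<kappa> * real n * s1 \<le> F s1"
      using b(2)[OF s1(1,3)] by linarith
    have "\<exists>s. s1 \<le> s \<and> s \<le> s0 \<and> F s - \<kappa> * real n * s = 0"
    proof (rule IVT2')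
      show "continuous_on {s1..s0} (\<lambda>s. F s - \<kappa> * real n * s)"
        using s1 s0 by (intro continuous_intros continuous_on_subset[OF F_continuous]) auto
    qed (use hi lo s1 in auto)
    then obtain s where "s1 \<le> s" "s \<le> s0" "F s - \<kappa> * real n * s = 0" by blast
    then show ?thesis
      using s1 by (intro exI[of _ s]) auto
  qed
  then show ?thesis
    using that[of n0] by (simp add: n0_def)
qed

text \<open>
  For large \<open>n\<close> let \<open>s\<close> solve \<open>F(s) = \<kappa> n s\<close> and let \<open>\<xi>\<close> be a fixed fraction of \<open>s\<close> with
  \<open>F(\<xi>) \<ge> 2 F(s)\<close>. The Remez inequality removes the neighbourhoods of the zeros where \<open>\<bar>g\<bar>\<close> may be
  smaller than \<open>s\<close> at the cost of a factor \<open>exp(F(s))\<close>, and on the remaining set \<open>V \<ge> exp(-F(s))\<close>.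
  Hence the unweighted norm of \<open>T\<close> is at most \<open>exp(F(\<xi>))\<close> times the norm of \<open>V T\<close>. This factor is
  compensated wherever \<open>\<bar>g\<bar> < \<xi>\<close>, since there both \<open>V\<close> and the polynomial \<open>q\<close> that replaces it are
  at most of order \<open>exp(-F(\<xi>))\<close>. On the rest of the circle \<open>V\<close> and \<open>q\<close> are comparable, and
  \<open>q T' = (q T)' - q' T\<close> is estimated by the Bernstein inequality for the weight \<open>u\<close>.
\<close>
lemma bernstein_singular_profile:
  fixes g g' V u :: "real \<Rightarrow> real" and p :: ennreal
  assumes per: "\<And>t. g (t + 2 * pi) = g t"
    and range: "\<And>t. \<bar>g t\<bar> \<le> A"
    and der: "\<And>t. DERIV g t :> g' t"
    and g': "\<And>t. \<bar>g' t\<bar> \<le> D" "\<And>s t. \<bar>g' s - g' t\<bar> \<le> D' * \<bar>s - t\<bar>"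
    and simple: "\<And>t. g t = 0 \<Longrightarrow> g' t \<noteq> 0"
    and V: "\<And>t. V t = (if g t = 0 then 0 else exp (- F \<bar>g t\<bar>))"
    and p: "0 < p" and u: "u \<in> class_B p" "u \<in> class_R_int p"
  shows "\<exists>C>0. \<forall>n\<ge>1. \<forall>T. trig_poly n T \<longrightarrow>
    Lp_norm p u circle (\<lambda>t. of_real (V t) * vector_derivative T (at t))
      \<le> ennreal (C * real n) * Lp_norm p u circle (\<lambda>t. of_real (V t) * T t)"
proof -
  define N where "N = Lp_norm p u circle"
  obtain CB where CB: "0 < CB" and bernstein: "\<And>n T T'. 1 \<le> n \<Longrightarrow> trig_poly n T \<Longrightarrow>
      (\<And>t. (T has_vector_derivative T' t) (at t)) \<Longrightarrow> N T' \<le> ennreal (CB * real n) * N T"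
  proof -
    obtain CB where CB: "0 < CB" "\<And>n T. 1 \<le> n \<Longrightarrow> trig_poly n T \<Longrightarrow>
        N (\<lambda>t. vector_derivative T (at t)) \<le> ennreal (CB * real n) * N T"
      using u(1) unfolding class_B_def N_def by blast
    have "(\<lambda>t. vector_derivative T (at t)) = T'" if "\<And>t. (T has_vector_derivative T' t) (at t)" for T T'
      using that by (auto simp: vector_derivative_at)
    then show ?thesis
      using that[OF CB(1)] CB(2) by metis
  qed
  obtain CR where CR: "0 < CR" and remez: "\<And>n T E. 1 \<le> n \<Longrightarrow> trig_poly n T \<Longrightarrow>
      interval_union (1 / real n) E \<Longrightarrow> measure lebesgue E \<le> 1 \<Longrightarrow>
      N T \<le> ennreal (exp (CR * real n * measure lebesgue E)) * Lp_norm p u (circle - E) T"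
    using u(2) unfolding class_R_int_def N_def by blast
  have w: "weight u"
    using u(1) by (simp add: class_B_def)
  then have u_nonneg: "0 \<le> u t" for t
    by (simp add: weight_def)
  have circ: "circle \<in> sets lebesgue"
    by (simp add: circle_def)
  note u_meas = weight_borel_measurable[OF w]
  have mono: "Lp_norm p u E f \<le> ennreal c * N h"
    if "E \<in> sets lebesgue" "E \<subseteq> circle" "f \<in> borel_measurable borel" "h \<in> borel_measurable borel"
      "0 < c" "\<And>t. t \<in> E \<Longrightarrow> cmod (f t) \<le> c * cmod (h t)" for E f h c
    unfolding N_def by (rule Lp_norm_mono[OF p u_nonneg circ u_meas that])
  have mono': "N f \<le> ennreal c * N h"
    if "f \<in> borel_measurable borel" "h \<in> borel_measurable borel" "0 < c"
      "\<And>t. cmod (f t) \<le> c * cmod (h t)" for f h c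
    using mono[OF circ order_refl that] by (simp add: N_def)
  define k where "k = 2 * 2 powr (1 / enn2real p)"
  have k: "0 < k" by (simp add: k_def)
  have tri: "N (\<lambda>t. f t + h t) \<le> ennreal k * (N f + N h)"
    if "f \<in> borel_measurable borel" "h \<in> borel_measurable borel" for f h
    unfolding N_def k_def by (rule Lp_norm_quasi_triangle[OF p u_nonneg circ u_meas that])

  have g_cont: "continuous_on UNIV g"
    using der DERIV_continuous_on has_field_derivative_at_within by blast
  then have g_meas [measurable]: "g \<in> borel_measurable borel"
    by (rule borel_measurable_continuous_onI)
  have V_meas [measurable]: "V \<in> borel_measurable borel"
  proof -
    have [measurable]: "(\<lambda>x. indicator {0<..A} x *\<^sub>R F x) \<in> borel_measurable borel"
      using F_continuous by (intro borel_measurable_continuous_on_indicator) auto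
    have "V t = (if g t = 0 then 0 else exp (- (indicator {0<..A} \<bar>g t\<bar> *\<^sub>R F \<bar>g t\<bar>)))" for t
      using range[of t] by (simp add: V indicator_def)
    moreover have "(\<lambda>t. if g t = 0 then 0 else exp (- (indicator {0<..A} \<bar>g t\<bar> *\<^sub>R F \<bar>g t\<bar>)))
        \<in> borel_measurable borel"
      using measurable_compose[of "\<lambda>t. \<bar>g t\<bar>" borel borel "\<lambda>x. indicator {0<..A} x *\<^sub>R F x" borel]
      by measurable
    ultimately show ?thesis
      by (simp cong: measurable_cong)
  qed

  obtain Z c where Z: "finite Z" "Z \<subseteq> {0..2 * pi}" and c: "c > 0"
    and zeros: "\<And>t r. t \<in> {0..2 * pi} \<Longrightarrow> 0 < r \<Longrightarrow> r \<le> 1 \<Longrightarrow> (\<And>z. z \<in> Z \<Longrightarrow> r \<le> \<bar>t - z\<bar>) \<Longrightarrow> c * r \<le> \<bar>g t\<bar>"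
    using simple_zeros_lower_bound[OF der simple] by metis
  obtain C1 where C1: "C1 > 0" and poly: "\<And>\<xi>. 0 < \<xi> \<Longrightarrow> \<xi> \<le> A \<Longrightarrow> 1 \<le> F \<xi> \<Longrightarrow> \<exists>d h. real d \<le> C1 * (F \<xi> / \<xi>) \<and>
       exp_approx d 3 (C1 * (F \<xi> / \<xi>)) h \<and>
       (\<forall>t. \<xi> \<le> \<bar>g t\<bar> \<longrightarrow> h t = - F \<bar>g t\<bar>) \<and> (\<forall>t. \<bar>g t\<bar> \<le> \<xi> \<longrightarrow> h t \<le> - F \<xi>)"
    using weight_polynomial[OF per range der g'] by blast

  \<comment> \<open>With \<open>r = s / c\<close>, the constant \<open>\<kappa>\<close> makes \<open>F s = \<kappa> n s\<close> equal to an upper bound for the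
    Remez exponent \<open>CR n \<bar>E\<bar>\<close>, and \<open>\<theta>\<close> yields the factor two in \<open>F (\<theta> s) \<ge> 2 F s\<close>.\<close>
  define m where "m = real (card Z) + 1"
  have m: "1 \<le> m" by (simp add: m_def)
  define \<kappa> where "\<kappa> = 6 * CR * m / c"
  have \<kappa>: "0 < \<kappa>" using CR m c by (simp add: \<kappa>_def)
  define \<theta> where "\<theta> = 2 powr (- 1 / A2)"
  have "\<theta> powr A2 = 2 powr (- 1)"
    using A2 by (simp only: \<theta>_def powr_powr) simp
  then have \<theta>: "0 < \<theta>" "\<theta> \<le> 1" "\<theta> powr A2 = 1 / 2"
    using A2 powr_mono[of "- 1 / A2" 0 2] by (auto simp: \<theta>_def powr_minus_divide)
  obtain b where b: "0 < b" "\<And>x. 0 < x \<Longrightarrow> x < b \<Longrightarrow> 1 + \<kappa> * c < F x"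
  proof -
    have "eventually (\<lambda>x. 1 + \<kappa> * c < F x) (at_right 0)"
      using F_blowup by (simp add: filterlim_at_top_dense)
    then show ?thesis
      using that by (auto simp: eventually_at_right_field)
  qed
  \<comment> \<open>The bounds on \<open>s0\<close> ensure that the intervals removed have length at least \<open>1 / n\<close>, because
    \<open>\<kappa> n s = F s > \<kappa> c\<close>, and total length at most one.\<close>
  define s0 where "s0 = min (b / 2) (min A (c / (6 * m)))"
  have s0: "0 < s0" "s0 \<le> A" "s0 < b" "s0 \<le> c / (6 * m)"
    using b A c m by (auto simp: s0_def)
  obtain n0 where n0: "1 \<le> n0" and scale: "\<And>n. n0 \<le> n \<Longrightarrow> \<exists>s. 0 < s \<and> s \<le> s0 \<and> F s = \<kappa> * real n * s"
    using choose_scale[OF \<kappa> s0(1,2)] by blast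
  define C2 where "C2 = C1 * (\<kappa> / (\<theta> powr A1 * \<theta>))"
  have C2: "0 < C2" using C1 \<kappa> \<theta> by (simp add: C2_def)
  define C where "C = k * (exp 3 * (k * (CB * (C2 + 1) + C2)) * (k * (exp 3 + exp 3)) + CB)"
  have C: "0 < C"
    unfolding C_def using k CB C2 by (intro mult_pos_pos add_pos_pos) auto

  have large: "N (\<lambda>t. of_real (V t) * T' t) \<le> ennreal (C * real n) * N (\<lambda>t. of_real (V t) * T t)"
    if n: "n0 \<le> n" and T: "trig_poly n T" "\<And>t. (T has_vector_derivative T' t) (at t)" "trig_poly n T'"
    for n T T'
  proof -
    have n1: "1 \<le> n" using n n0 by simp
    obtain s where s: "0 < s" "s \<le> s0" "F s = \<kappa> * real n * s"
      using scale[OF n] by blast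
    have sA: "s \<le> A" using s s0 by simp
    define r where "r = s / c"
    define \<xi> where "\<xi> = \<theta> * s"
    have \<xi>: "0 < \<xi>" "\<xi> \<le> s" "\<xi> \<le> A" "\<xi> < b"
    proof -
      show "0 < \<xi>"
        using \<theta> s by (simp add: \<xi>_def)
      show "\<xi> \<le> s"
        using mult_right_mono[OF \<theta>(2), of s] s by (simp add: \<xi>_def)
      then show "\<xi> \<le> A" "\<xi> < b"
        using s s0 by linarith+
    qed
    have r: "0 < r" "6 * r * m \<le> 1"
    proof -
      show "0 < r" using s c by (simp add: r_def)
      have "s * (6 * m) \<le> s0 * (6 * m)"
        using s(2) m by (intro mult_right_mono) auto
      also have "\<dots> \<le> c"
        using s0(4) m by (simp add: field_simps)
      finally have "s * (6 * m) \<le> c" .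
      then show "6 * r * m \<le> 1"
        using c by (simp add: r_def field_simps)
    qed
    have "6 * r * 1 \<le> 6 * r * m"
      using r m by (intro mult_left_mono) auto
    then have r1: "r \<le> 1" using r by linarith
    have F2: "2 * F s \<le> F \<xi>"
      using F_scale[OF s(1) sA \<theta>(1,2)] by (simp add: \<theta>(3) \<xi>_def)
    have F1: "1 \<le> F \<xi>"
      using b(2)[OF \<xi>(1,4)] \<kappa> c by (smt (verit) mult_pos_pos)

    define E where "E = circle_proj (\<Union>z\<in>Z. {z - r..z + r})"
    have E: "interval_union (1 / real n) E" "E \<in> sets lebesgue" "measure lebesgue E \<le> 6 * r * m"
      "measure lebesgue E \<le> 1"
    proof -
      have "1 + \<kappa> * c < \<kappa> * real n * s"
        using b(2)[of s] s s0 by simp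
      then have "\<kappa> * c < \<kappa> * (real n * s)"
        by (simp add: mult.assoc)
      then have "c < real n * s"
        using \<kappa> by simp
      then have "1 / real n \<le> r"
        using n1 c by (simp add: r_def field_simps)
      then show "interval_union (1 / real n) E"
        unfolding E_def using r by (intro remez_set(1)[OF Z r(1) r1]) auto
      show "E \<in> sets lebesgue"
        unfolding E_def by (rule remez_set(2)[OF Z r(1) r1])
      have "measure lebesgue E \<le> 6 * r * real (card Z)"
        unfolding E_def by (rule remez_set(3)[OF Z r(1) r1])
      also have "\<dots> \<le> 6 * r * m"
        using r by (intro mult_left_mono) (auto simp: m_def)
      finally show "measure lebesgue E \<le> 6 * r * m" .
      then show "measure lebesgue E \<le> 1" using r by linarith
    qed
    have VT_meas: "(\<lambda>t. of_real (V t) * S t) \<in> borel_measurable borel" if "trig_poly n S" for S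
      using trig_poly_borel_measurable[OF that] by measurable
    have outside: "exp (- F s) \<le> V t" if "t \<in> circle - E" for t
    proof -
      have "c * r \<le> \<bar>g t\<bar>"
        using that remez_set(4)[OF Z r(1) r1, of t]
        by (intro zeros r(1) r1) (auto simp: E_def circle_def)
      then have "s \<le> \<bar>g t\<bar>"
        using c by (simp add: r_def)
      then show ?thesis
        using F_antimono[OF s(1) _ range] s by (auto simp: V)
    qed
    have whole: "N T \<le> ennreal (exp (F \<xi>)) * N (\<lambda>t. of_real (V t) * T t)"
    proof -
      have "N T \<le> ennreal (exp (CR * real n * measure lebesgue E)) * Lp_norm p u (circle - E) T"
        by (rule remez[OF n1 T(1) E(1,4)])
      moreover have "Lp_norm p u (circle - E) T \<le> ennreal (exp (F s)) * N (\<lambda>t. of_real (V t) * T t)"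
      proof (rule mono)
        fix t assume "t \<in> circle - E"
        then have "1 \<le> exp (F s) * V t"
          using outside[of t] by (simp add: exp_minus field_simps)
        from mult_right_mono[OF this norm_ge_zero[of "T t"]]
        show "cmod (T t) \<le> exp (F s) * cmod (of_real (V t) * T t)"
          by (simp add: norm_mult V)
      qed (use E(2) circ T VT_meas trig_poly_borel_measurable in auto)
      ultimately have "N T \<le> ennreal (exp (CR * real n * measure lebesgue E) * exp (F s))
          * N (\<lambda>t. of_real (V t) * T t)"
        by (rule ennreal_chain) auto
      also have "\<dots> \<le> ennreal (exp (F \<xi>)) * N (\<lambda>t. of_real (V t) * T t)"
      proof (intro mult_right_mono ennreal_leI)
        have "CR * real n * measure lebesgue E \<le> CR * real n * (6 * r * m)"
          using E(3) CR by (intro mult_left_mono) auto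
        also have "\<dots> = F s"
          using c by (simp add: s(3) \<kappa>_def r_def)
        finally show "exp (CR * real n * measure lebesgue E) * exp (F s) \<le> exp (F \<xi>)"
          using F2 by (simp flip: exp_add)
      qed auto
      finally show ?thesis .
    qed

    obtain d h where d: "real d \<le> C1 * (F \<xi> / \<xi>)" and approx: "exp_approx d 3 (C1 * (F \<xi> / \<xi>)) h"
      and h: "\<And>t. \<xi> \<le> \<bar>g t\<bar> \<Longrightarrow> h t = - F \<bar>g t\<bar>" "\<And>t. \<bar>g t\<bar> \<le> \<xi> \<Longrightarrow> h t \<le> - F \<xi>"
      using poly[OF \<xi>(1,3) F1] by blast
    have rate: "C1 * (F \<xi> / \<xi>) \<le> C2 * real n"
    proof -
      have "F \<xi> \<le> F s / \<theta> powr A1"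
        using F_scale_upper[OF s(1) sA \<theta>(1,2)] \<theta>(1) by (simp add: \<xi>_def field_simps)
      then have "F \<xi> / \<xi> \<le> F s / \<theta> powr A1 / \<xi>"
        using \<xi> by (intro divide_right_mono) auto
      also have "\<dots> = \<kappa> / (\<theta> powr A1 * \<theta>) * real n"
        using s by (simp add: s(3) \<xi>_def)
      finally have "C1 * (F \<xi> / \<xi>) \<le> C1 * (\<kappa> / (\<theta> powr A1 * \<theta>) * real n)"
        using C1 by (intro mult_left_mono) auto
      then show ?thesis
        by (simp only: C2_def mult.assoc)
    qed
    obtain q q' where q: "trig_poly d (\<lambda>t. complex_of_real (q t))" "\<And>t. DERIV q t :> q' t"
      "\<And>t. exp (h t - 3) \<le> q t" "\<And>t. q t \<le> exp (h t + 3)" "\<And>t. \<bar>q' t\<bar> \<le> C1 * (F \<xi> / \<xi>) * q t"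
      using approx unfolding exp_approx_def by blast
    have q0: "0 < q t" for t
      using q(3)[of t] exp_gt_zero less_le_trans by blast
    have q_cmp: "q t \<le> exp 3 * V t" "V t \<le> exp 3 * q t" if "\<xi> \<le> \<bar>g t\<bar>" for t
    proof -
      have Vt: "V t = exp (h t)"
        using h(1)[OF that] that \<xi>(1) by (auto simp: V)
      show "q t \<le> exp 3 * V t"
        using q(4)[of t] unfolding Vt exp_add by (simp add: mult.commute)
      show "V t \<le> exp 3 * q t"
        using mult_left_mono[OF q(3)[of t], of "exp 3"] unfolding Vt by (simp flip: exp_add)
    qed
    have q_small: "q t \<le> exp (3 - F \<xi>)" "V t \<le> exp (- F \<xi>)" if "\<bar>g t\<bar> \<le> \<xi>" for t
    proof -
      have "exp (h t + 3) \<le> exp (3 - F \<xi>)"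
        using h(2)[OF that] by simp
      then show "q t \<le> exp (3 - F \<xi>)"
        using q(4)[of t] by linarith
      show "V t \<le> exp (- F \<xi>)"
        using F_antimono[of "\<bar>g t\<bar>" \<xi>] that \<xi> by (auto simp: V)
    qed
    define Q where "Q = (\<lambda>t. complex_of_real (q t))"
    obtain Q' where Q': "trig_poly d Q'" "\<And>t. (Q has_vector_derivative Q' t) (at t)"
      using trig_poly_has_derivative[OF q(1)] unfolding Q_def by blast
    have Q'_le: "cmod (Q' t) \<le> C2 * real n * q t" for t
    proof -
      have "(Q has_vector_derivative complex_of_real (q' t)) (at t)"
        using q(2)[of t] unfolding Q_def
        by (simp add: has_real_derivative_iff_has_vector_derivative has_vector_derivative_of_real)
      then have "Q' t = complex_of_real (q' t)"
        using Q'(2) vector_derivative_unique_at by blast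
      then have "cmod (Q' t) \<le> C1 * (F \<xi> / \<xi>) * q t"
        using q(5)[of t] by simp
      also have "\<dots> \<le> C2 * real n * q t"
        using rate q0[of t] by (intro mult_right_mono) auto
      finally show ?thesis .
    qed
    note [measurable] = trig_poly_borel_measurable[OF T(1)] trig_poly_borel_measurable[OF T(3)]
      trig_poly_borel_measurable[OF q(1), folded Q_def] trig_poly_borel_measurable[OF Q'(1)]
    define B where "B = {t. \<bar>g t\<bar> < \<xi>}"
    have B [measurable]: "B \<in> sets borel"
      unfolding B_def by measurable

    \<comment> \<open>On the set \<open>B\<close> the smallness of the weight absorbs the unweighted norm.\<close>
    have QT: "N (\<lambda>t. Q t * T t) \<le> ennreal (k * (exp 3 + exp 3)) * N (\<lambda>t. of_real (V t) * T t)"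
    proof (rule ennreal_chain_add)
      have "N (\<lambda>t. indicator (- B) t * (Q t * T t) + indicator B t * (Q t * T t))
          \<le> ennreal k * (N (\<lambda>t. indicator (- B) t * (Q t * T t)) + N (\<lambda>t. indicator B t * (Q t * T t)))"
        by (rule tri) measurable
      moreover have "(\<lambda>t. indicator (- B) t * (Q t * T t) + indicator B t * (Q t * T t)) = (\<lambda>t. Q t * T t)"
        by (auto simp: indicator_def)
      ultimately show "N (\<lambda>t. Q t * T t)
          \<le> ennreal k * (N (\<lambda>t. indicator (- B) t * (Q t * T t)) + N (\<lambda>t. indicator B t * (Q t * T t)))"
        by simp
      show "N (\<lambda>t. indicator (- B) t * (Q t * T t)) \<le> ennreal (exp 3) * N (\<lambda>t. of_real (V t) * T t)"
      proof (rule mono')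
        fix t
        show "cmod (indicator (- B) t * (Q t * T t)) \<le> exp 3 * cmod (of_real (V t) * T t)"
        proof (cases "t \<in> B")
          case False
          then have "q t * cmod (T t) \<le> exp 3 * V t * cmod (T t)"
            by (intro mult_right_mono q_cmp) (auto simp: B_def)
          then show ?thesis
            using False q0[of t] by (simp add: norm_mult Q_def V mult.assoc)
        qed simp
      qed measurable
      have "N (\<lambda>t. indicator B t * (Q t * T t)) \<le> ennreal (exp (3 - F \<xi>)) * N T"
      proof (rule mono')
        fix t
        show "cmod (indicator B t * (Q t * T t)) \<le> exp (3 - F \<xi>) * cmod (T t)"
        proof (cases "t \<in> B")
          case True
          then have "q t * cmod (T t) \<le> exp (3 - F \<xi>) * cmod (T t)"
            by (intro mult_right_mono q_small) (auto simp: B_def)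
          then show ?thesis
            using True q0[of t] by (simp add: norm_mult Q_def)
        qed simp
      qed measurable
      from ennreal_chain[OF this whole]
      show "N (\<lambda>t. indicator B t * (Q t * T t)) \<le> ennreal (exp 3) * N (\<lambda>t. of_real (V t) * T t)"
        by (simp flip: exp_add)
    qed (use k in auto)

    \<comment> \<open>The Bernstein inequality for \<open>u\<close> applies to the product \<open>Q T\<close>, whose degree is still of
      order \<open>n\<close>.\<close>
    have QT': "N (\<lambda>t. Q t * T' t) \<le> ennreal (k * (CB * (C2 + 1) + C2) * real n) * N (\<lambda>t. Q t * T t)"
    proof -
      have "N (\<lambda>t. (Q t * T' t + Q' t * T t) + (- (Q' t * T t)))
          \<le> ennreal (k * (CB * (C2 + 1) * real n + C2 * real n)) * N (\<lambda>t. Q t * T t)"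
      proof (rule ennreal_chain_add[OF tri])
        have "N (\<lambda>t. Q t * T' t + Q' t * T t) \<le> ennreal (CB * real (d + n)) * N (\<lambda>t. Q t * T t)"
        proof (rule bernstein)
          show "trig_poly (d + n) (\<lambda>t. Q t * T t)"
            unfolding Q_def by (rule trig_poly_mult[OF q(1) T(1)])
          show "((\<lambda>t. Q t * T t) has_vector_derivative Q t * T' t + Q' t * T t) (at t)" for t
            by (rule has_vector_derivative_mult[OF Q'(2) T(2)])
        qed (use n1 in simp)
        also have "\<dots> \<le> ennreal (CB * (C2 + 1) * real n) * N (\<lambda>t. Q t * T t)"
        proof (intro mult_right_mono ennreal_leI)
          have "real (d + n) \<le> (C2 + 1) * real n"
            using d rate by (simp add: distrib_right)
          then show "CB * real (d + n) \<le> CB * (C2 + 1) * real n"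
            using CB by (simp add: mult.assoc)
        qed simp
        finally show "N (\<lambda>t. Q t * T' t + Q' t * T t) \<le> ennreal (CB * (C2 + 1) * real n) * N (\<lambda>t. Q t * T t)" .
        show "N (\<lambda>t. - (Q' t * T t)) \<le> ennreal (C2 * real n) * N (\<lambda>t. Q t * T t)"
        proof (rule mono')
          fix t
          show "cmod (- (Q' t * T t)) \<le> C2 * real n * cmod (Q t * T t)"
            using mult_right_mono[OF Q'_le[of t] norm_ge_zero[of "T t"]] q0[of t]
            by (simp add: norm_mult Q_def mult.assoc)
        qed (use C2 n1 in \<open>measurable, simp\<close>)
      qed (use k CB C2 in \<open>measurable, auto\<close>)
      then show ?thesis
        by (simp add: algebra_simps)
    qed

    have "N (\<lambda>t. of_real (V t) * T' t)
        \<le> ennreal (k * (exp 3 * (k * (CB * (C2 + 1) + C2) * real n) * (k * (exp 3 + exp 3)) + CB * real n))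
          * N (\<lambda>t. of_real (V t) * T t)"
    proof (rule ennreal_chain_add)
      have "N (\<lambda>t. indicator (- B) t * (of_real (V t) * T' t) + indicator B t * (of_real (V t) * T' t))
          \<le> ennreal k * (N (\<lambda>t. indicator (- B) t * (of_real (V t) * T' t))
            + N (\<lambda>t. indicator B t * (of_real (V t) * T' t)))"
        by (rule tri) measurable
      moreover have "(\<lambda>t. indicator (- B) t * (of_real (V t) * T' t) + indicator B t * (of_real (V t) * T' t))
          = (\<lambda>t. of_real (V t) * T' t)"
        by (auto simp: indicator_def)
      ultimately show "N (\<lambda>t. of_real (V t) * T' t)
          \<le> ennreal k * (N (\<lambda>t. indicator (- B) t * (of_real (V t) * T' t))
            + N (\<lambda>t. indicator B t * (of_real (V t) * T' t)))"
        by simp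
      have "N (\<lambda>t. indicator (- B) t * (of_real (V t) * T' t)) \<le> ennreal (exp 3) * N (\<lambda>t. Q t * T' t)"
      proof (rule mono')
        fix t
        show "cmod (indicator (- B) t * (of_real (V t) * T' t)) \<le> exp 3 * cmod (Q t * T' t)"
        proof (cases "t \<in> B")
          case False
          then have "V t * cmod (T' t) \<le> exp 3 * q t * cmod (T' t)"
            by (intro mult_right_mono q_cmp) (auto simp: B_def)
          then show ?thesis
            using False q0[of t] by (simp add: norm_mult Q_def V mult.assoc)
        qed simp
      qed measurable
      from ennreal_chain[OF ennreal_chain[OF this QT'] QT]
      show "N (\<lambda>t. indicator (- B) t * (of_real (V t) * T' t))
          \<le> ennreal (exp 3 * (k * (CB * (C2 + 1) + C2) * real n) * (k * (exp 3 + exp 3)))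
            * N (\<lambda>t. of_real (V t) * T t)"
        using k CB C2 by simp
      have "N (\<lambda>t. indicator B t * (of_real (V t) * T' t)) \<le> ennreal (exp (- F \<xi>)) * N T'"
      proof (rule mono')
        fix t
        show "cmod (indicator B t * (of_real (V t) * T' t)) \<le> exp (- F \<xi>) * cmod (T' t)"
        proof (cases "t \<in> B")
          case True
          then have "V t * cmod (T' t) \<le> exp (- F \<xi>) * cmod (T' t)"
            by (intro mult_right_mono q_small) (auto simp: B_def)
          then show ?thesis
            using True by (simp add: norm_mult V)
        qed simp
      qed measurable
      from ennreal_chain[OF ennreal_chain[OF this bernstein[OF n1 T(1,2)]] whole]
      have "N (\<lambda>t. indicator B t * (of_real (V t) * T' t))
          \<le> ennreal (exp (- F \<xi>) * (CB * real n) * exp (F \<xi>)) * N (\<lambda>t. of_real (V t) * T t)"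
        using CB by simp
      also have "exp (- F \<xi>) * (CB * real n) * exp (F \<xi>) = CB * real n"
        by (simp add: exp_minus)
      finally show "N (\<lambda>t. indicator B t * (of_real (V t) * T' t)) \<le> ennreal (CB * real n)
          * N (\<lambda>t. of_real (V t) * T t)" .
    qed (use k CB C2 in auto)
    moreover have "k * (exp 3 * (k * (CB * (C2 + 1) + C2) * real n) * (k * (exp 3 + exp 3)) + CB * real n)
        = C * real n"
      by (simp add: C_def algebra_simps)
    ultimately show ?thesis by simp
  qed

  \<comment> \<open>A polynomial of degree \<open>n < n0\<close> is treated as one of degree \<open>n0\<close>.\<close>
  show ?thesis
  proof (intro exI[of _ "C * real n0"] conjI allI impI)
    fix n T assume n: "1 \<le> n" and T: "trig_poly n T"
    define j where "j = max n n0"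
    have "trig_poly j T"
      using trig_poly_mono[OF T] by (simp add: j_def)
    then obtain T' where T': "trig_poly j T'" "\<And>t. (T has_vector_derivative T' t) (at t)"
      using trig_poly_has_derivative by blast
    have "N (\<lambda>t. of_real (V t) * T' t) \<le> ennreal (C * real j) * N (\<lambda>t. of_real (V t) * T t)"
      using \<open>trig_poly j T\<close> T' by (intro large) (auto simp: j_def)
    also have "\<dots> \<le> ennreal (C * real n0 * real n) * N (\<lambda>t. of_real (V t) * T t)"
    proof (intro mult_right_mono ennreal_leI)
      have "j \<le> n0 * n"
        using n n0 by (auto simp: j_def)
      then have "real j \<le> real n0 * real n"
        by (metis of_nat_le_iff of_nat_mult)
      then show "C * real j \<le> C * real n0 * real n"
        using C by (simp add: mult.assoc)
    qed simp
    also have "T' = (\<lambda>t. vector_derivative T (at t))"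
      by (intro ext vector_derivative_at[symmetric] T'(2))
    finally show "Lp_norm p u circle (\<lambda>t. of_real (V t) * vector_derivative T (at t))
      \<le> ennreal (C * real n0 * real n) * Lp_norm p u circle (\<lambda>t. of_real (V t) * T t)"
      by (simp add: N_def)
  qed (use C n0 in auto)
qed

end

theorem theorem6p1:
  fixes p :: ennreal and \<omega> u :: "real \<Rightarrow> real"
  assumes "0 < p"
    and "\<omega> \<in> class_Omega"
    and "u \<in> class_B p \<inter> class_R_int p"
  shows "\<exists>C::real. C > 0 \<and> (\<forall>n\<ge>1. \<forall>T. trig_poly n T \<longrightarrow>
           Lp_norm p (\<lambda>t. \<omega> t * u t) circle (\<lambda>t. vector_derivative T (at t))
             \<le> ennreal (C * real n) * Lp_norm p (\<lambda>t. \<omega> t * u t) circle T)"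
proof -
  obtain A g F where A: "A > 0" and g: "admissible_g A g" and F: "admissible_F A F"
    and \<omega>: "\<omega> = (\<lambda>t. if g t = 0 then 0 else exp (- F (g t)))"
    using assms(2) unfolding class_Omega_def by blast
  obtain d D where per: "periodic_2pi g" and range: "\<And>t. g t \<in> {-A..A}"
    and d: "derivs_on UNIV g d" and D: "D > 0" "\<And>n t. n \<ge> 1 \<Longrightarrow> \<bar>d n t\<bar> \<le> D ^ n * fact n"
    and simple: "\<And>t. g t = 0 \<Longrightarrow> d 1 t \<noteq> 0"
    using g unfolding admissible_g_def by blast
  have "d 0 = g"
    using d by (auto simp: derivs_on_def)
  moreover have "DERIV (d n) t :> d (Suc n) t" for n t
    using d by (simp add: derivs_on_def)
  ultimately have g1: "DERIV g t :> d 1 t" and g2: "DERIV (d 1) t :> d 2 t" for t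
    by (metis One_nat_def Suc_1)+
  have d1: "\<bar>d 1 t\<bar> \<le> D" for t
    using D(2)[of 1 t] by simp
  have d2: "\<bar>d 1 s - d 1 t\<bar> \<le> 2 * D\<^sup>2 * \<bar>s - t\<bar>" for s t
  proof (rule field_differentiable_bound[of UNIV "d 1" "d 2", simplified real_norm_def])
    show "\<bar>d 2 z\<bar> \<le> 2 * D\<^sup>2" for z
      using D(2)[of 2 z] by (simp add: fact_numeral)
  qed (use g2 in auto)

  obtain f B A1 A2 where F_pos: "\<And>x. x \<in> {-A..A} - {0} \<Longrightarrow> F x > 0"
    and F_even: "\<And>x. x \<in> {-A..A} - {0} \<Longrightarrow> F (- x) = F x"
    and F_lim: "filterlim F at_top (at_right 0)" and F_anti: "antimono_on {0<..A} F"
    and f: "derivs_on {0<..A} F f"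
    and B: "\<And>n x. n \<ge> 1 \<Longrightarrow> x \<in> {0<..A} \<Longrightarrow> \<bar>f n x\<bar> \<le> B ^ n * real n ^ n * F x / x ^ n"
    and A12: "A1 > 0" "A2 > 0"
      "\<And>x. x \<in> {0<..A} \<Longrightarrow> A2 \<le> \<bar>f 1 x\<bar> * x / F x \<and> \<bar>f 1 x\<bar> * x / F x \<le> A1"
    using F unfolding admissible_F_def by blast
  have f1: "(F has_real_derivative f 1 x) (at x within {0<..A})" if "x \<in> {0<..A}" for x
  proof (rule has_field_derivative_transform_within[OF _ zero_less_one that])
    show "(f 0 has_real_derivative f 1 x) (at x within {0<..A})"
      using f that by (simp add: derivs_on_def)
  qed (use f in \<open>auto simp: derivs_on_def\<close>)
  have f2: "(f 1 has_real_derivative f 2 x) (at x within {0<..A})" if "x \<in> {0<..A}" for x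
  proof -
    have "(f 1 has_real_derivative f (Suc 1) x) (at x within {0<..A})"
      using f that unfolding derivs_on_def by blast
    then show ?thesis by (simp add: numeral_2_eq_2)
  qed
  have f1_nonpos: "f 1 x \<le> 0" if "x \<in> {0<..A}" for x
  proof -
    have "x / 2 \<in> {0<..A}" "x / 2 \<noteq> x"
      using that by auto
    then have "{0<..A} \<noteq> {y}" for y
      using that by (metis singletonD)
    moreover have "connected {0<..A}"
      by (intro convex_connected convex_real_interval)
    ultimately have "x islimpt {0<..A}"
      using connected_imp_perfect[OF _ that] by blast
    then have "at x within {0<..A} \<noteq> bot"
      unfolding trivial_limit_within by blast
    moreover have "((\<lambda>y. (F y - F x) / (y - x)) \<longlongrightarrow> f 1 x) (at x within {0<..A})"
      using f1[OF that] by (simp add: has_field_derivative_iff)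
    moreover have "(F y - F x) / (y - x) \<le> 0" if "y \<in> {0<..A}" for y
      using monotone_onD[OF F_anti that \<open>x \<in> {0<..A}\<close>] monotone_onD[OF F_anti \<open>x \<in> {0<..A}\<close> that]
      by (cases "y \<le> x") (auto simp: divide_le_0_iff)
    then have "eventually (\<lambda>y. (F y - F x) / (y - x) \<le> 0) (at x within {0<..A})"
      by (auto simp: eventually_at_filter)
    ultimately show ?thesis
      using tendsto_upperbound by blast
  qed

  define q where "q = (if p = \<infinity> then 1 else 1 / enn2real p)"
  have q: "q > 0"
    using enn2real_pos[OF assms(1)] by (simp add: q_def)
  define V where "V = (\<lambda>t. if g t = 0 then 0 else exp (- (q * F \<bar>g t\<bar>)))"
  have F_abs: "F \<bar>g t\<bar> = F (g t)" if "g t \<noteq> 0" for t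
    using F_even[of "g t"] range[of t] that by (auto simp: abs_if)
  have \<omega>V: "\<omega> t = (if p = \<infinity> then V t else V t powr enn2real p)" for t
    using enn2real_pos[OF assms(1)] F_abs[of t]
    by (auto simp: \<omega> V_def q_def powr_def)
  have V_nonneg: "0 \<le> V t" for t
    by (simp add: V_def)
  interpret singular_profile A A1 A2 "4 * B\<^sup>2" "\<lambda>x. q * F x" "\<lambda>x. q * f 1 x" "\<lambda>x. q * f 2 x"
  proof
    show "0 < A" "0 < A2" by fact+
    fix x assume x: "x \<in> {0<..A}"
    then have x0: "0 < x" "0 < F x"
      using F_pos[of x] by auto
    show "0 < q * F x" using q x0 by simp
    show "((\<lambda>x. q * F x) has_real_derivative q * f 1 x) (at x within {0<..A})"
      "((\<lambda>x. q * f 1 x) has_real_derivative q * f 2 x) (at x within {0<..A})"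
      using DERIV_cmult[OF f1[OF x]] DERIV_cmult[OF f2[OF x]] by auto
    have "A2 * F x / x \<le> - f 1 x" "- f 1 x \<le> A1 * F x / x"
      using A12(3)[OF x] f1_nonpos[OF x] x0 by (auto simp: field_simps)
    from this[THEN mult_left_mono, of q] q
    show "A2 * (q * F x) / x \<le> - (q * f 1 x)" "- (q * f 1 x) \<le> A1 * (q * F x) / x"
      by (auto simp: mult_ac)
    have "\<bar>f 2 x\<bar> \<le> 4 * B\<^sup>2 * F x / x\<^sup>2"
      using B[of 2 x] x by (simp add: mult.commute)
    from mult_left_mono[OF this, of q] q
    show "\<bar>q * f 2 x\<bar> \<le> 4 * B\<^sup>2 * (q * F x) / x\<^sup>2"
      by (simp add: abs_mult mult_ac)
  next
    show "filterlim (\<lambda>x. q * F x) at_top (at_right 0)"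
      using q F_lim by (intro filterlim_tendsto_pos_mult_at_top[OF tendsto_const])
  qed
  have "\<exists>C>0. \<forall>n\<ge>1. \<forall>T. trig_poly n T \<longrightarrow>
    Lp_norm p u circle (\<lambda>t. of_real (V t) * vector_derivative T (at t))
      \<le> ennreal (C * real n) * Lp_norm p u circle (\<lambda>t. of_real (V t) * T t)"
  proof (rule bernstein_singular_profile[of g "d 1" D "2 * D\<^sup>2"])
    show "g (t + 2 * pi) = g t" for t
      using per by (simp add: periodic_2pi_def)
    show "\<bar>g t\<bar> \<le> A" for t
      using range[of t] by (auto simp: abs_le_iff)
    show "V t = (if g t = 0 then 0 else exp (- (q * F \<bar>g t\<bar>)))" for t
      by (simp add: V_def)
  qed (use g1 d1 d2 simple assms in auto)
  then show ?thesis
    unfolding Lp_norm_weight_product[OF V_nonneg \<omega>V] .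
qed

end
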